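(* Let $M$ be a $3$-connected matroid. If $|E(M)|\ge 7$, then $M$ contains at least four elastic elements provided $M$ has no $4$-element fans and no $\Theta$-separators. Moreover, if $|E(M)|\le 6$, then every element of $M$ is elastic.
   Context: Let $M$ be a matroid with ground set $E(M)$, rank function $r$, and dual $M^*$ with rank function $r^*$; write $r(M)=r(E(M))$ and $r^*(M)=r^*(E(M))$. For $X\subseteq E(M)$, the connectivity function is $\lambda_M(X)=r(X)+r(E(M)-X)-r(M)$. A partition $(X,E(M)-X)$ is a $k$-separation if $\lambda_M(X)\le k-1$ and $\min\{|X|,|E(M)-X|\}\ge k$. A matroid is $n$-connected if it has no $k$-separations for all $k<n$. Elastic elements: $\operatorname{si}(N)$ and $\operatorname{co}(N)$ denote the simplification and cosimplification of $N$. An element $e$ of a $3$-connected matroid $M$ is deletable if $\operatorname{co}(M\backslash e)$ is $3$-connected, contractible if $\operatorname{si}(M/e)$ is $3$-connected, and elastic if it is both deletable and contractible. Fans: a triangle is a $3$-element circuit and a triad is a $3$-element cocircuit. A $4$-element subset $F$ of $E(M)$ is a $4$-element fan if it has an ordering $(f_1,f_2,f_3,f_4)$ such that one of $\{f_1,f_2,f_3\}$ and $\{f_2,f_3,f_4\}$ is a triangle and the other is a triad. The matroids $\Theta_n$ and $\Theta_n^-$: for $n\ge 2$, $\Theta_n$ is the matroid whose ground set is the disjoint union of $W=\{w_1,\dots,w_n\}$ and $Z=\{z_1,\dots,z_n\}$ and whose circuits are: all $3$-element subsets of $W$; all sets $(Z-\{z_i\})\cup\{w_i\}$ with $i\in\{1,\dots,n\}$;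 and all sets $(Z-\{z_i\})\cup\{w_j,w_k\}$ with $i,j,k$ distinct elements of $\{1,\dots,n\}$. Up to isomorphism $\Theta_n\backslash w_i$ does not depend on $i$, and is denoted $\Theta_n^-$. $\Theta$-separators: let $M$ be $3$-connected and let $A$ and $B$ be a rank-$2$ subset and a corank-$2$ subset of $E(M)$, respectively (that is, $r(A)=2$ and $r^*(B)=2$). The set $A\cup B$ is a $\Theta$-separator of $M$ if $r(M)\ge 4$ and $r^*(M)\ge 4$, and either $M|(A\cup B)$ or $M^*|(A\cup B)$ is isomorphic to one of $\Theta_n$ and $\Theta_n^-$ for some $n\ge 3$. *)

theory Defs
  imports Main
begin

record 'a pre_matroid =
  ground :: "'a set"
  indep :: "'a set \<Rightarrow> bool"

locale matroid =
  fixes M :: "'a pre_matroid"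
  assumes finite_ground: "finite (ground M)"
    and indep_subset_ground: "indep M I \<Longrightarrow> I \<subseteq> ground M"
    and indep_empty: "indep M {}"
    and indep_subset: "indep M I \<Longrightarrow> J \<subseteq> I \<Longrightarrow> indep M J"
    and augmentation:
      "indep M I \<Longrightarrow> indep M J \<Longrightarrow> card I < card J \<Longrightarrow> \<exists>x\<in>J - I. indep M (insert x I)"

definition matroid_iso :: "'a pre_matroid \<Rightarrow> 'b pre_matroid \<Rightarrow> bool" where
  "matroid_iso M N \<longleftrightarrow>
    (\<exists>f. bij_betw f (ground M) (ground N) \<and>
         (\<forall>X\<subseteq>ground M. indep M X \<longleftrightarrow> indep N (f ` X)))"

definition matroid_rank :: "'a pre_matroid \<Rightarrow> 'a set \<Rightarrow> nat" where
  "matroid_rank M X = Max (card ` {I. I \<subseteq> X \<and> indep M I})"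

definition basis :: "'a pre_matroid \<Rightarrow> 'a set \<Rightarrow> bool" where
  "basis M B \<longleftrightarrow> indep M B \<and> (\<forall>I. indep M I \<longrightarrow> B \<subseteq> I \<longrightarrow> I = B)"

definition circuit :: "'a pre_matroid \<Rightarrow> 'a set \<Rightarrow> bool" where
  "circuit M C \<longleftrightarrow> C \<subseteq> ground M \<and> \<not> indep M C \<and> (\<forall>I. I \<subset> C \<longrightarrow> indep M I)"

text \<open>The bases of the dual are the complements of the bases.\<close>

definition matroid_dual :: "'a pre_matroid \<Rightarrow> 'a pre_matroid" where
  "matroid_dual M =
    \<lparr>ground = ground M,
     indep = (\<lambda>I. \<exists>B. basis M B \<and> I \<subseteq> ground M - B)\<rparr>"

definition cocircuit :: "'a pre_matroid \<Rightarrow> 'a set \<Rightarrow> bool" where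
  "cocircuit M C \<longleftrightarrow> circuit (matroid_dual M) C"

definition matroid_restrict :: "'a pre_matroid \<Rightarrow> 'a set \<Rightarrow> 'a pre_matroid" where
  "matroid_restrict M X = \<lparr>ground = ground M \<inter> X, indep = (\<lambda>I. indep M I \<and> I \<subseteq> X)\<rparr>"

definition matroid_delete :: "'a pre_matroid \<Rightarrow> 'a set \<Rightarrow> 'a pre_matroid" where
  "matroid_delete M X = matroid_restrict M (ground M - X)"

definition matroid_contract :: "'a pre_matroid \<Rightarrow> 'a set \<Rightarrow> 'a pre_matroid" where
  "matroid_contract M X = matroid_dual (matroid_delete (matroid_dual M) X)"

definition connectivity :: "'a pre_matroid \<Rightarrow> 'a set \<Rightarrow> int" where
  "connectivity M X =
    int (matroid_rank M X) + int (matroid_rank M (ground M - X)) - int (matroid_rank M (ground M))"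

definition k_separation :: "'a pre_matroid \<Rightarrow> nat \<Rightarrow> 'a set \<Rightarrow> bool" where
  "k_separation M k X \<longleftrightarrow>
    X \<subseteq> ground M \<and> connectivity M X \<le> int k - 1 \<and>
    k \<le> min (card X) (card (ground M - X))"

text \<open>The value \<open>k = 0\<close> is harmless: \<open>connectivity\<close> is an integer and never negative
  for a matroid, so there are no \<open>0\<close>-separations.\<close>

definition n_connected :: "nat \<Rightarrow> 'a pre_matroid \<Rightarrow> bool" where
  "n_connected n M \<longleftrightarrow> (\<forall>k<n. \<not> (\<exists>X. k_separation M k X))"

definition is_loop :: "'a pre_matroid \<Rightarrow> 'a \<Rightarrow> bool" where
  "is_loop M e \<longleftrightarrow> circuit M {e}"

definition parallel_class :: "'a pre_matroid \<Rightarrow> 'a \<Rightarrow> 'a set" where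
  "parallel_class M e = {f \<in> ground M. \<not> is_loop M f \<and> (f = e \<or> circuit M {e, f})}"

text \<open>Simplification deletes all loops and all but one element of every parallel class. It is
  unique only up to isomorphism; the retained elements are selected by Hilbert choice, which
  picks the same element for all members of a class.\<close>

definition simplification :: "'a pre_matroid \<Rightarrow> 'a pre_matroid" where
  "simplification M =
    matroid_restrict M ((\<lambda>e. SOME f. f \<in> parallel_class M e) ` {e \<in> ground M. \<not> is_loop M e})"

definition cosimplification :: "'a pre_matroid \<Rightarrow> 'a pre_matroid" where
  "cosimplification M = matroid_dual (simplification (matroid_dual M))"

definition deletable :: "'a pre_matroid \<Rightarrow> 'a \<Rightarrow> bool" where
  "deletable M e \<longleftrightarrow> e \<in> ground M \<and> n_connected 3 (cosimplification (matroid_delete M {e}))"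

definition contractible :: "'a pre_matroid \<Rightarrow> 'a \<Rightarrow> bool" where
  "contractible M e \<longleftrightarrow> e \<in> ground M \<and> n_connected 3 (simplification (matroid_contract M {e}))"

definition elastic :: "'a pre_matroid \<Rightarrow> 'a \<Rightarrow> bool" where
  "elastic M e \<longleftrightarrow> deletable M e \<and> contractible M e"

definition triangle :: "'a pre_matroid \<Rightarrow> 'a set \<Rightarrow> bool" where
  "triangle M T \<longleftrightarrow> circuit M T \<and> card T = 3"

definition triad :: "'a pre_matroid \<Rightarrow> 'a set \<Rightarrow> bool" where
  "triad M T \<longleftrightarrow> cocircuit M T \<and> card T = 3"

definition four_element_fan :: "'a pre_matroid \<Rightarrow> 'a set \<Rightarrow> bool" where
  "four_element_fan M F \<longleftrightarrow>
    F \<subseteq> ground M \<and> card F = 4 \<and>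
    (\<exists>f1 f2 f3 f4. F = {f1, f2, f3, f4} \<and>
       (triangle M {f1, f2, f3} \<and> triad M {f2, f3, f4} \<or>
        triad M {f1, f2, f3} \<and> triangle M {f2, f3, f4}))"

datatype theta_elem = W nat | Z nat

definition theta_circuits :: "nat \<Rightarrow> theta_elem set set" where
  "theta_circuits n =
    {C. C \<subseteq> W ` {1..n} \<and> card C = 3} \<union>
    {(Z ` {1..n} - {Z i}) \<union> {W i} | i. i \<in> {1..n}} \<union>
    {(Z ` {1..n} - {Z i}) \<union> {W j, W k} | i j k.
       i \<in> {1..n} \<and> j \<in> {1..n} \<and> k \<in> {1..n} \<and> i \<noteq> j \<and> i \<noteq> k \<and> j \<noteq> k}"

definition theta :: "nat \<Rightarrow> theta_elem pre_matroid" where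
  "theta n =
    \<lparr>ground = W ` {1..n} \<union> Z ` {1..n},
     indep = (\<lambda>I. I \<subseteq> W ` {1..n} \<union> Z ` {1..n} \<and> (\<forall>C\<in>theta_circuits n. \<not> C \<subseteq> I))\<rparr>"

text \<open>Permuting the indices shows that any other \<open>W i\<close> with \<open>1 \<le> i \<le> n\<close> gives an isomorphic
  matroid.\<close>

definition theta_minus :: "nat \<Rightarrow> theta_elem pre_matroid" where
  "theta_minus n = matroid_delete (theta n) {W 1}"

definition theta_separator :: "'a pre_matroid \<Rightarrow> 'a set \<Rightarrow> bool" where
  "theta_separator M S \<longleftrightarrow>
    (\<exists>A B. A \<subseteq> ground M \<and> B \<subseteq> ground M \<and> S = A \<union> B \<and>
       matroid_rank M A = 2 \<and> matroid_rank (matroid_dual M) B = 2) \<and>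
    matroid_rank M (ground M) \<ge> 4 \<and>
    matroid_rank (matroid_dual M) (ground M) \<ge> 4 \<and>
    (\<exists>n\<ge>3. \<exists>N\<in>{matroid_restrict M S, matroid_restrict (matroid_dual M) S}.
       matroid_iso N (theta n) \<or> matroid_iso N (theta_minus n))"

end

theory Submission
  imports Defs
begin

text \<open>Write \<open>r\<close> and \<open>s\<close> for the rank functions of \<open>M\<close> and of its dual, and
\<open>\<lambda>\<close> for the connectivity function. If an element \<open>e\<close> of a 3-connected matroid is not contractible,
then pulling a 2-separation of the simplification of \<open>M/e\<close> back to \<open>M\<close> gives a partition
\<open>(X, {e}, Y)\<close> with \<open>\<lambda>(X) = \<lambda>(Y) = 2\<close>, with \<open>r(X), r(Y) \<ge> 3\<close>, and with \<open>e\<close> in the closures of \<open>X\<close> and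
of \<open>Y\<close>; if \<open>e\<close> is not deletable, the same holds in the dual (\<open>separation3_of_not_elastic\<close>). Such a
partition needs at least seven elements, so every element is elastic when there are at most six.
For the other half it is enough that each side of such a partition contains two elastic elements
(\<open>two_unblocked_in_side\<close>): either all elements are elastic, or the two sides of one partition
supply two each.

This is an induction on the size of the side \<open>X\<close>, and it rests on two arguments.

\<^item> Uncrossing. Let \<open>f\<close> in \<open>X\<close> be nonelastic, with partition \<open>(P, {f}, Q)\<close>. Submodularity of \<open>\<lambda>\<close> leaves three
  possibilities (\<open>crossing\<close>): a smaller side inside \<open>X\<close>, where the induction applies; a set \<open>P\<close> that
  sticks out of \<open>X\<close> in a single element, where \<open>X \<inter> P\<close> has rank two and that element in its coclosure, so that
  it is a line of at least three elements or completes a fan;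
  or \<open>X\<close> is the union of two lines through \<open>f\<close>. If one of the two lines has at most two elements, the
  other is again a line with an element outside it in its coclosure. If both have at least three,
  then \<open>r(X) = 3\<close> and \<open>s(X) \<ge> 4\<close>, which excludes the dual situation for other elements of \<open>X\<close>, and only one
  element of \<open>X\<close> can be of this kind (\<open>unique_line_pair\<close>); so all the others are elastic.

\<^item> A line \<open>L\<close> of at least three elements with an element \<open>h\<close> outside it in its coclosure
  (\<open>two_unblocked_on_coclosed_line\<close>). Apart from at most one element, \<open>L \<union> {h}\<close> is the complement of a
  hyperplane \<open>G\<close>. Every element of \<open>L - G\<close> is deletable. If two of them are not contractible, then their
  partitions uncross so tightly that for each of them, say \<open>f\<close>, there is an element \<open>z\<close> of \<open>G\<close> such that
  the complement of \<open>(W - {f}) \<union> {z}\<close> does not span, where \<open>W\<close> is the closure of \<open>L - G\<close>. If all but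
  at most one element of \<open>L - G\<close> is not contractible, then \<open>W\<close> together with these elements \<open>z\<close>, and with \<open>h\<close> if \<open>W\<close> meets \<open>G\<close>, is a
  \<open>\<Theta>\<close>-separator, unless \<open>W\<close> is a triangle, and then it gives a 4-element fan.

Both arguments are also needed with \<open>r\<close> and \<open>s\<close> exchanged; therefore the combinatorial
part is about a pair of mutually dual rank functions rather than about a matroid.\<close>

section \<open>Rank functions and their duals\<close>

text \<open>Both a rank function and its dual are parameters, although either determines the other: as the axioms are
preserved when \<open>r\<close> and \<open>s\<close> are exchanged (lemma \<open>dual\<close>), duality is a change of parameters and double duals
never have to be rewritten. Values are integers because differences of ranks occur throughout.\<close>

locale rank_pair =
  fixes E :: "'a set" and r s :: "'a set \<Rightarrow> int"
  assumes fin: "finite E"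
    and r_empty: "r {} = 0"
    and r_step: "A \<subseteq> E \<Longrightarrow> x \<in> E \<Longrightarrow> r A \<le> r (insert x A) \<and> r (insert x A) \<le> r A + 1"
    and r_submod: "A \<subseteq> E \<Longrightarrow> B \<subseteq> E \<Longrightarrow> r (A \<union> B) + r (A \<inter> B) \<le> r A + r B"
    and s_eq: "A \<subseteq> E \<Longrightarrow> s A = int (card A) + r (E - A) - r E"
begin

lemma finite_sub: "A \<subseteq> E \<Longrightarrow> finite A"
  using fin finite_subset by blast

lemma card_compl: "A \<subseteq> E \<Longrightarrow> int (card (E - A)) = int (card E) - int (card A)"
  using fin by (simp add: card_Diff_subset card_mono finite_sub of_nat_diff)

lemma r_mono: assumes "A \<subseteq> B" "B \<subseteq> E" shows "r A \<le> r B"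
proof -
  have "finite B" using assms finite_sub by blast
  hence "finite (B - A)" by simp
  moreover have "C \<subseteq> B - A \<Longrightarrow> r A \<le> r (A \<union> C)" if "finite C" for C
    using that
  proof (induction C)
    case (insert x C)
    have "A \<union> C \<subseteq> E" "x \<in> E" using insert assms by auto
    thus ?case using r_step[of "A \<union> C" x] insert by fastforce
  qed simp
  ultimately have "r A \<le> r (A \<union> (B - A))" by blast
  thus ?thesis using assms by (simp add: Un_absorb1)
qed

lemma r_nonneg: "A \<subseteq> E \<Longrightarrow> 0 \<le> r A"
  using r_mono[of "{}" A] r_empty by simp

lemma r_le_union_card: assumes "A \<subseteq> E" "B \<subseteq> E" shows "r (A \<union> B) \<le> r A + int (card B)"
proof -
  have "finite B" using assms finite_sub by blast
  moreover have "finite C \<Longrightarrow> C \<subseteq> B \<Longrightarrow> r (A \<union> C) \<le> r A + int (card C)" for C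
  proof (induction C rule: finite_induct)
    case (insert x C)
    have "A \<union> C \<subseteq> E" "x \<in> E" using insert assms by auto
    thus ?case using r_step[of "A \<union> C" x] insert by fastforce
  qed simp
  ultimately show ?thesis by blast
qed

lemma r_le_card: "A \<subseteq> E \<Longrightarrow> r A \<le> int (card A)"
  using r_le_union_card[of "{}" A] r_empty by simp

lemma r_diff_card: assumes "A \<subseteq> E" "B \<subseteq> E" shows "r (A - B) + int (card B) \<ge> r A"
proof -
  have "r A \<le> r ((A - B) \<union> B)" using assms by (intro r_mono) auto
  also have "\<dots> \<le> r (A - B) + int (card B)" using assms by (intro r_le_union_card) auto
  finally show ?thesis by simp
qed

definition cl :: "'a set \<Rightarrow> 'a set" where
  "cl A = {x \<in> E. r (insert x A) = r A}"

lemma cl_sub: "cl A \<subseteq> E" by (auto simp: cl_def)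

lemma cl_ext: "A \<subseteq> E \<Longrightarrow> A \<subseteq> cl A" by (auto simp: cl_def insert_absorb)

lemma cl_mono: assumes "A \<subseteq> B" "B \<subseteq> E" shows "cl A \<subseteq> cl B"
proof
  fix x assume x: "x \<in> cl A"
  hence xE: "x \<in> E" and rx: "r (insert x A) = r A" by (auto simp: cl_def)
  show "x \<in> cl B"
  proof (cases "x \<in> B")
    case True thus ?thesis using xE by (simp add: cl_def insert_absorb)
  next
    case False
    have "insert x A \<union> B = insert x B" "insert x A \<inter> B = A" using assms False by auto
    hence "r (insert x B) \<le> r B"
      using r_submod[of "insert x A" B] assms xE rx by auto
    thus ?thesis using r_step[of B x] assms xE by (auto simp: cl_def)
  qed
qed

lemma r_Un_cl: assumes "A \<subseteq> E" "B \<subseteq> cl A" shows "r (A \<union> B) = r A"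
proof -
  have "finite B" using assms(2) cl_sub[of A] finite_sub[of B] by simp
  moreover have "finite C \<Longrightarrow> C \<subseteq> B \<Longrightarrow> r (A \<union> C) = r A" for C
  proof (induction C rule: finite_induct)
    case (insert x C)
    have "C \<subseteq> E" using insert assms cl_sub[of A] by auto
    hence "x \<in> cl (A \<union> C)" using cl_mono[of A "A \<union> C"] insert assms by blast
    thus ?case using insert by (auto simp: cl_def)
  qed simp
  ultimately show ?thesis by blast
qed

lemma r_cl: "A \<subseteq> E \<Longrightarrow> r (cl A) = r A"
  using r_Un_cl[of A "cl A"] cl_ext[of A] by (simp add: Un_absorb1)

lemma r_sub_cl: assumes "A \<subseteq> E" "B \<subseteq> cl A" shows "r B \<le> r A"
  using r_mono[of B "cl A"] r_cl assms cl_sub by metis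

lemma in_clI: assumes "A \<subseteq> B" "x \<in> B" "B \<subseteq> E" "r B \<le> r A" shows "x \<in> cl A"
proof -
  have "r (insert x A) \<le> r B" using assms by (intro r_mono) auto
  moreover have "r A \<le> r (insert x A)" using assms by (intro r_mono) auto
  ultimately show ?thesis using assms by (auto simp: cl_def)
qed

lemma cl_least: assumes "A \<subseteq> E" "B \<subseteq> cl A" shows "cl B \<subseteq> cl A"
proof
  fix x assume "x \<in> cl B"
  hence "x \<in> cl (cl A)" using cl_mono[OF assms(2) cl_sub] by blast
  hence "r (insert x (cl A)) = r A" "x \<in> E" using r_cl assms by (auto simp: cl_def)
  thus "x \<in> cl A" using cl_ext[OF assms(1)] cl_sub
    by (intro in_clI[of A "insert x (cl A)"]) auto
qed

lemma cl_exchange: assumes "A \<subseteq> E" "y \<in> E" "x \<in> cl (insert y A)" "x \<notin> cl A"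
  shows "y \<in> cl (insert x A)"
proof -
  have xE: "x \<in> E" using assms cl_sub by blast
  have "r (insert x A) = r A + 1" using assms xE r_step[of A x] by (auto simp: cl_def)
  moreover have "r (insert x (insert y A)) = r (insert y A)" using assms by (auto simp: cl_def)
  moreover have "r (insert y A) \<le> r A + 1" using assms r_step by blast
  moreover have "r (insert x A) \<le> r (insert x (insert y A))" using assms xE by (intro r_mono) auto
  ultimately show ?thesis using assms by (simp add: cl_def insert_commute)
qed

lemma r_insert_notin_cl: assumes "A \<subseteq> E" "x \<in> E" "x \<notin> cl A" shows "r (insert x A) = r A + 1"
  using r_step[of A x] assms by (auto simp: cl_def)

text \<open>The connectivity function \<open>\<lambda>\<close>, in the form that is visibly symmetric in \<open>r\<close> and \<open>s\<close>.\<close>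

definition lam :: "'a set \<Rightarrow> int" where
  "lam A = r A + s A - int (card A)"

lemma lam_eq: "A \<subseteq> E \<Longrightarrow> lam A = r A + r (E - A) - r E"
  by (simp add: lam_def s_eq)

lemma lam_submod: assumes "A \<subseteq> E" "B \<subseteq> E" shows "lam (A \<union> B) + lam (A \<inter> B) \<le> lam A + lam B"
proof -
  have "r ((E - A) \<union> (E - B)) + r ((E - A) \<inter> (E - B)) \<le> r (E - A) + r (E - B)"
    by (intro r_submod) auto
  moreover have "(E - A) \<union> (E - B) = E - (A \<inter> B)" "(E - A) \<inter> (E - B) = E - (A \<union> B)" by auto
  moreover have "A \<union> B \<subseteq> E" "A \<inter> B \<subseteq> E" using assms by auto
  ultimately show ?thesis using r_submod[OF assms] assms by (simp add: lam_eq)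
qed

lemma dual: "rank_pair E s r"
proof
  show "finite E" by (rule fin)
  show "s {} = 0" using s_eq[of "{}"] by simp
  show "s A \<le> s (insert x A) \<and> s (insert x A) \<le> s A + 1" if "A \<subseteq> E" "x \<in> E" for A x
  proof (cases "x \<in> A")
    case False
    have "insert x (E - insert x A) = E - A" using that False by auto
    thus ?thesis using r_step[of "E - insert x A" x] that s_eq[of A] s_eq[of "insert x A"] False
        finite_sub[of A] by auto
  qed (simp add: insert_absorb)
  show "s (A \<union> B) + s (A \<inter> B) \<le> s A + s B" if "A \<subseteq> E" "B \<subseteq> E" for A B
  proof -
    have "int (card A) + int (card B) = int (card (A \<union> B)) + int (card (A \<inter> B))"
      using card_Un_Int[of A B] finite_sub that by (metis of_nat_add)
    moreover have "lam (A \<union> B) + lam (A \<inter> B) \<le> lam A + lam B" using lam_submod that by blast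
    moreover have "r ((E - A) \<union> (E - B)) + r ((E - A) \<inter> (E - B)) \<le> r (E - A) + r (E - B)"
      by (intro r_submod) auto
    moreover have "(E - A) \<union> (E - B) = E - (A \<inter> B)" "(E - A) \<inter> (E - B) = E - (A \<union> B)" by auto
    moreover have "A \<union> B \<subseteq> E" "A \<inter> B \<subseteq> E" using that by auto
    ultimately show ?thesis using that by (simp add: s_eq)
  qed
  show "r A = int (card A) + s (E - A) - s E" if "A \<subseteq> E" for A
    using that s_eq[of "E - A"] s_eq[of E] card_compl[of A] r_empty by (simp add: double_diff)
qed

lemma rank_attained: assumes "A \<subseteq> E" shows "\<exists>I\<subseteq>A. r I = int (card I) \<and> r I = r A"
proof -
  let ?F = "{I. I \<subseteq> A \<and> r I = int (card I)}"
  have "?F \<subseteq> Pow A" by auto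
  hence "finite ?F" using finite_sub[OF assms] finite_subset by blast
  moreover have "{} \<in> ?F" using r_empty by simp
  ultimately have "Max (card ` ?F) \<in> card ` ?F" "\<And>J. J \<in> ?F \<Longrightarrow> card J \<le> Max (card ` ?F)"
    by (intro Max_in Max_ge; fastforce)+
  then obtain I where I: "I \<in> ?F" "\<And>J. J \<in> ?F \<Longrightarrow> card J \<le> card I" by fastforce
  have IE: "I \<subseteq> E" "finite I" using I assms finite_sub by auto
  have "A \<subseteq> cl I"
  proof
    fix x assume x: "x \<in> A"
    show "x \<in> cl I"
    proof (rule ccontr)
      assume n: "x \<notin> cl I"
      hence "x \<notin> I" using cl_ext[OF IE(1)] by auto
      moreover have "r (insert x I) = r I + 1" using n x assms IE by (intro r_insert_notin_cl) auto
      ultimately have "insert x I \<in> ?F" using I x IE by auto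
      thus False using I(2)[of "insert x I"] \<open>x \<notin> I\<close> IE by simp
    qed
  qed
  hence "r (I \<union> A) = r I" using r_Un_cl IE by blast
  moreover have "I \<union> A = A" using I by auto
  ultimately show ?thesis using I by auto
qed

text \<open>An element \<open>x\<close> outside \<open>A\<close> lies in the coclosure of \<open>A\<close> iff it is a coloop of the restriction to the complement of \<open>A\<close>.\<close>

lemma s_insert_iff: assumes "A \<subseteq> E" "x \<in> E" "x \<notin> A"
  shows "s (insert x A) = s A \<longleftrightarrow> r (E - A) = r (E - insert x A) + 1"
  using assms s_eq[of A] s_eq[of "insert x A"] finite_sub[of A] by auto

end

section \<open>3-connectivity and 3-separations with an element in the guts\<close>

locale connected_pair = rank_pair +
  assumes big: "7 \<le> card E"
    and conn1: "A \<subseteq> E \<Longrightarrow> A \<noteq> {} \<Longrightarrow> A \<noteq> E \<Longrightarrow> 1 \<le> lam A"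
    and conn2: "A \<subseteq> E \<Longrightarrow> 2 \<le> card A \<Longrightarrow> 2 \<le> card (E - A) \<Longrightarrow> 2 \<le> lam A"
begin

lemma dual_conn: "connected_pair E s r"
proof -
  interpret D: rank_pair E s r by (rule dual)
  have l: "D.lam A = lam A" for A by (simp add: D.lam_def lam_def)
  show ?thesis by unfold_locales (use big conn1 conn2 in \<open>auto simp: l\<close>)
qed

lemma r_single: assumes "x \<in> E" shows "r {x} = 1"
proof -
  have "{x} \<noteq> E" using big by auto
  hence "1 \<le> lam {x}" using conn1[of "{x}"] assms by auto
  moreover have "r (E - {x}) \<le> r E" by (intro r_mono) auto
  ultimately show ?thesis using lam_eq[of "{x}"] assms r_le_card[of "{x}"] by auto
qed

text \<open>The dual of \<open>r_single\<close>: there are no coloops.\<close>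

lemma r_del1: assumes "x \<in> E" shows "r (E - {x}) = r E"
proof -
  have "{x} \<noteq> E" using big by auto
  hence "1 \<le> lam {x}" using conn1[of "{x}"] assms by auto
  moreover have "r (E - {x}) \<le> r E" by (intro r_mono) auto
  ultimately show ?thesis using lam_eq[of "{x}"] assms r_single[of x] by auto
qed

lemma lam_single: "x \<in> E \<Longrightarrow> lam {x} = 1"
  using lam_eq[of "{x}"] r_single r_del1 by auto

lemma r_pair: assumes "x \<in> E" "y \<in> E" "x \<noteq> y" shows "r {x,y} = 2" "r (E - {x,y}) = r E"
proof -
  have c: "card {x,y} = 2" using assms by simp
  have "int (card (E - {x,y})) = int (card E) - 2" using card_compl[of "{x,y}"] c assms by auto
  hence "2 \<le> card (E - {x,y})" using big by linarith
  hence "2 \<le> lam {x,y}" using conn2[of "{x,y}"] assms c by auto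
  moreover have "r (E - {x,y}) \<le> r E" by (intro r_mono) auto
  moreover have "r {x,y} \<le> 2" using r_le_card[of "{x,y}"] assms c by auto
  ultimately show "r {x,y} = 2" "r (E - {x,y}) = r E" using lam_eq[of "{x,y}"] assms by auto
qed

lemma lam_small: assumes "A \<subseteq> E" "lam A \<le> 1" "2 \<le> card (E - A)" shows "card A \<le> 1"
  using conn2[of A] assms by force

lemma card_ge_of_r: "A \<subseteq> E \<Longrightarrow> int k \<le> r A \<Longrightarrow> k \<le> card A"
  using r_le_card[of A] by simp

lemma r_ge2: assumes "A \<subseteq> E" "x \<in> A" "y \<in> A" "x \<noteq> y" shows "2 \<le> r A"
  using r_mono[of "{x,y}" A] r_pair(1)[of x y] assms by (simp add: subset_iff)

lemma line_cl: assumes "L \<subseteq> E" "r L \<le> 2" "x \<in> L" "y \<in> L" "x \<noteq> y" shows "L \<subseteq> cl {x,y}"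
proof
  fix z assume "z \<in> L"
  moreover have "r {x,y} = 2" using r_pair(1)[of x y] assms by blast
  ultimately show "z \<in> cl {x,y}" using assms by (intro in_clI[of _ L]) auto
qed

lemma two_elems: assumes "2 \<le> card A" obtains x y where "x \<in> A" "y \<in> A" "x \<noteq> y"
proof -
  have "\<not> card A \<le> Suc 0" using assms by simp
  thus ?thesis using that card_le_Suc0_iff_eq[of A] assms card.infinite by fastforce
qed

end

text \<open>The partitions that witness nonelastic elements. For the rank function of a matroid this is a vertical 3-separation
\<open>(P, {f}, Q)\<close> with \<open>f\<close> in both closures; for the rank function of the dual it is a cyclic one.\<close>

definition separation3 :: "'a set \<Rightarrow> ('a set \<Rightarrow> int) \<Rightarrow> 'a set \<Rightarrow> 'a \<Rightarrow> 'a set \<Rightarrow> bool" where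
  "separation3 E r P f Q \<longleftrightarrow>
     E = insert f (P \<union> Q) \<and> f \<notin> P \<and> f \<notin> Q \<and> P \<inter> Q = {} \<and>
     3 \<le> r P \<and> 3 \<le> r Q \<and> r (insert f P) = r P \<and> r (insert f Q) = r Q \<and> r P + r Q = r E + 2"

lemma separation3_sym: "separation3 E r P f Q \<Longrightarrow> separation3 E r Q f P"
  by (auto simp: separation3_def)

context connected_pair begin

lemma separation3_sub: "separation3 E r P f Q \<Longrightarrow> P \<subseteq> E \<and> Q \<subseteq> E \<and> f \<in> E"
  by (auto simp: separation3_def)

lemma separation3_cl: "separation3 E r P f Q \<Longrightarrow> f \<in> cl P \<and> f \<in> cl Q"
  using separation3_sub[of P f Q] unfolding separation3_def cl_def by blast

lemma separation3_compl:
  "separation3 E r P f Q \<Longrightarrow> E - P = insert f Q \<and> E - insert f P = Q"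
  by (auto simp: separation3_def)

lemma separation3_lam: assumes "separation3 E r P f Q" shows "lam P = 2" "lam (insert f P) = 2"
  using separation3_compl[OF assms] separation3_sub[OF assms] assms
  by (auto simp: separation3_def lam_eq)

text \<open>Moving the closure of one side to that side costs nothing: what is left of \<open>Q\<close> has at least two elements,
because a set missing at most one element spans, and then \<open>\<lambda> \<ge> 2\<close> forces it to keep the rank of \<open>Q\<close>.\<close>

lemma separation3_close: assumes S: "separation3 E r P f Q"
  shows "separation3 E r (cl P - {f}) f (Q - cl P)"
proof -
  have S': "f \<notin> P" "f \<notin> Q" "P \<inter> Q = {}" "3 \<le> r P" "3 \<le> r Q" "r (insert f P) = r P"
    "r (insert f Q) = r Q" "r P + r Q = r E + 2" and U: "insert f (P \<union> Q) = E"
    using S unfolding separation3_def by blast+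
  have sub: "P \<subseteq> E" "Q \<subseteq> E" "f \<in> E" using separation3_sub[OF S] by auto
  have f: "f \<in> cl P" using separation3_cl[OF S] by blast
  have Pcl: "P \<subseteq> cl P" by (rule cl_ext[OF sub(1)])
  have rc: "r (cl P) = r P" by (rule r_cl[OF sub(1)])
  have E: "E - (Q - cl P) = cl P" using S' U Pcl f cl_sub[of P] by blast
  have "2 \<le> card (Q - cl P)"
  proof (rule ccontr)
    assume "\<not> 2 \<le> card (Q - cl P)"
    hence c: "card (Q - cl P) \<le> Suc 0" by simp
    have fQ: "finite (Q - cl P)" using sub finite_sub by blast
    have "r E \<le> r (cl P)"
    proof (cases "Q - cl P = {}")
      case True
      hence "cl P = E" using E by (metis Diff_empty)
      thus ?thesis by simp
    next
      case False
      then obtain x where "Q - cl P = {x}" using c fQ by (metis card_1_singletonE card_0_eq le_Suc_eq le_zero_eq One_nat_def)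
      thus ?thesis using E r_del1[of x] sub by auto
    qed
    thus False using rc S' by linarith
  qed
  moreover have "2 \<le> card (cl P)" using card_ge_of_r[of "cl P" 2] cl_sub[of P] rc S' by simp
  ultimately have "2 \<le> lam (Q - cl P)" using conn2[of "Q - cl P"] E sub by auto
  moreover have QE: "Q - cl P \<subseteq> E" using sub by auto
  ultimately have "r Q \<le> r (Q - cl P)" using lam_eq[OF QE] E rc S' by simp
  moreover have "r (Q - cl P) \<le> r Q" using sub by (intro r_mono) auto
  ultimately have rQ: "r (Q - cl P) = r Q" by simp
  have "f \<in> cl (Q - cl P)" using rQ S' sub by (intro in_clI[of _ "insert f Q"]) auto
  hence 1: "r (insert f (Q - cl P)) = r Q" using rQ by (simp add: cl_def)
  have "r P \<le> r (cl P - {f})" using Pcl S' cl_sub[of P] by (intro r_mono) auto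
  moreover have "r (cl P - {f}) \<le> r (cl P)" using cl_sub[of P] by (intro r_mono) auto
  ultimately have 2: "r (cl P - {f}) = r P" using rc by simp
  have 3: "insert f (cl P - {f}) = cl P" using f by auto
  have "E = insert f ((cl P - {f}) \<union> (Q - cl P))" using E f cl_sub[of P] sub by blast
  thus ?thesis unfolding separation3_def using 1 2 3 rQ rc S' by auto
qed

end

text \<open>The traces of a \<open>\<Theta>\<close>-separator on ranks: a line \<open>W\<close> of at least four elements, and for all but at most one of
its elements \<open>f\<close> a partner \<open>z f\<close> off the line such that \<open>(W - {f}) \<union> {z f}\<close> contains a cocircuit.
In the dual \<open>W\<close> plays the part of the elements \<open>z\<^sub>i\<close> of \<open>\<Theta>\<^sub>n\<close>, and the partners are the \<open>w\<^sub>i\<close>.\<close>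

definition theta_configuration :: "'a set \<Rightarrow> ('a set \<Rightarrow> int) \<Rightarrow> bool" where
  "theta_configuration E r \<longleftrightarrow>
     (\<exists>W B z. W \<subseteq> E \<and> r W \<le> 2 \<and> 4 \<le> card W \<and> 4 \<le> r E \<and> B \<subseteq> W \<and> card W \<le> card B + 1 \<and>
        inj_on z B \<and> z ` B \<subseteq> E - W \<and> (\<forall>f\<in>B. r (E - insert (z f) (W - {f})) < r E))"

text \<open>In a 3-connected matroid with at least seven elements all pairs have rank and corank two, so a triangle is a
3-element set of rank at most two; exchanging \<open>r\<close> and \<open>s\<close> only reverses the order of a fan.\<close>

locale tame_pair = connected_pair +
  assumes no_fan: "distinct [a,b,c,d] \<Longrightarrow> {a,b,c,d} \<subseteq> E \<Longrightarrow> r {a,b,c} \<le> 2 \<Longrightarrow> s {b,c,d} \<le> 2 \<Longrightarrow> False"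
    and no_theta: "\<not> theta_configuration E r"
    and no_theta_dual: "\<not> theta_configuration E s"
begin

lemma dual_tame: "tame_pair E s r"
proof -
  interpret D: connected_pair E s r by (rule dual_conn)
  show ?thesis
  proof
    show False if "distinct [a,b,c,d]" "{a,b,c,d} \<subseteq> E" "s {a,b,c} \<le> 2" "r {b,c,d} \<le> 2" for a b c d
      using no_fan[of d c b a] that by (auto simp: insert_commute)
  qed (rule no_theta_dual no_theta)+
qed

text \<open>Every nonelastic element is blocked, by \<open>separation3_of_not_elastic\<close> below.\<close>

definition blocked :: "'a \<Rightarrow> bool" where
  "blocked f \<longleftrightarrow> (\<exists>P Q. separation3 E r P f Q \<or> separation3 E s P f Q)"

end

section \<open>A line completing a hyperplane\<close>

text \<open>The line \<open>L\<close> and the element \<open>h\<close> together form the complement of the hyperplane \<open>G\<close>. Elements of \<open>G\<close> on the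
closure of \<open>L\<close> are allowed; there is at most one (\<open>line_meets_hyperplane_once\<close>).\<close>

locale line_and_hyperplane = tame_pair +
  fixes G L h
  assumes E_eq: "E = insert h (G \<union> L)" and hG: "h \<notin> G" and hL: "h \<notin> L" and GL: "G \<inter> L = {}"
    and G_flat: "cl G = G" and rG: "r G = r E - 1" and rL: "r L \<le> 2" and cL: "3 \<le> card L"
begin

lemma sub: "G \<subseteq> E" "L \<subseteq> E" "h \<in> E" using E_eq by auto

lemma line_absorb: assumes "A \<subseteq> E" "x \<in> cl A" "y \<in> cl A" "x \<in> cl L" "y \<in> cl L" "x \<noteq> y"
  shows "cl L \<subseteq> cl A"
proof -
  have "cl L \<subseteq> cl {x,y}"
    using assms line_cl[of "cl L" x y] cl_sub[of L] r_cl[of L] sub rL by auto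
  also have "\<dots> \<subseteq> cl A" using assms by (intro cl_least) auto
  finally show ?thesis .
qed

text \<open>This yields that \<open>f\<close> is deletable. In a separation of the dual, \<open>f\<close> lies in neither of the closures of \<open>P\<close> and \<open>Q\<close>, so each
side contains at most one further element of the line. Hence \<open>L\<close> is a triangle split between the sides, and
deleting its element from the side that avoids \<open>h\<close> leaves a subset \<open>P'\<close> of \<open>G\<close> with \<open>\<lambda>(P') = 1\<close>.\<close>

lemma not_dual_blocked: assumes "f \<in> L" shows "\<not> separation3 E s P f Q"
proof
  assume "separation3 E s P f Q"
  moreover have False if S: "separation3 E s P f Q" and hQ: "h \<in> Q" for P Q
  proof -
    interpret D: connected_pair E s r by (rule dual_conn)
    note S' = S[unfolded separation3_def]
    have sb: "P \<subseteq> E" "Q \<subseteq> E" "f \<in> E" using S' by auto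
    have cm: "E - P = insert f Q" "E - insert f P = Q" "E - Q = insert f P" "E - insert f Q = P"
      using D.separation3_compl[OF S] D.separation3_compl[OF separation3_sym[OF S]] by auto
    have rQ: "r (insert f Q) = r Q + 1" using s_insert_iff[of P f] S' cm sb by auto
    have rP: "r (insert f P) = r P + 1" using s_insert_iff[of Q f] S' cm sb by auto
    have "lam P = 2" using D.separation3_lam(1)[OF S] by (simp add: D.lam_def lam_def)
    hence sum: "r P + r Q = r E + 1" using lam_eq[of P] cm sb rQ by auto
    have fcl: "f \<notin> cl P" "f \<notin> cl Q" using rP rQ by (auto simp: cl_def)
    have one: False if "A \<subseteq> E" "f \<notin> cl A" "x \<in> A" "y \<in> A" "x \<in> L" "y \<in> L" "x \<noteq> y" for A x y
    proof -
      have "A \<subseteq> cl A" "L \<subseteq> cl L" using that sub cl_ext by auto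
      hence "cl L \<subseteq> cl A" using that by (intro line_absorb[of A x y]) auto
      thus False using \<open>L \<subseteq> cl L\<close> assms that by auto
    qed
    have "2 \<le> card (L - {f})" using cL assms finite_sub[OF sub(2)] by simp
    then obtain a b where "a \<in> L - {f}" "b \<in> L - {f}" "a \<noteq> b" by (rule two_elems)
    hence ab: "a \<in> L" "b \<in> L" "a \<noteq> b" "a \<noteq> f" "b \<noteq> f" by auto
    have "a \<in> P \<union> Q" "b \<in> P \<union> Q" using ab sub S' by auto
    moreover have "\<not> (a \<in> P \<and> b \<in> P)" "\<not> (a \<in> Q \<and> b \<in> Q)"
      using one[of P a b] one[of Q a b] fcl sb ab by auto
    ultimately have "a \<in> P \<and> b \<in> Q \<or> b \<in> P \<and> a \<in> Q" by auto
    hence "\<exists>g k. {a,b} = {g,k} \<and> g \<in> P \<and> k \<in> Q" by blast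
    then obtain g k where gk: "{a,b} = {g,k}" "g \<in> P" "k \<in> Q" by blast
    have gkL: "g \<in> L" "k \<in> L" "g \<noteq> k" "g \<noteq> f" "k \<noteq> f" using gk ab by (auto simp: doubleton_eq_iff)
    define P' where "P' = P - {g}"
    have PG: "P' \<subseteq> G"
    proof
      fix x assume x: "x \<in> P'"
      hence "x \<notin> L" using one[of P g x] gk gkL fcl sb unfolding P'_def by auto
      moreover have "x \<noteq> h" "x \<in> E" using x hQ S' sb unfolding P'_def by auto
      ultimately show "x \<in> G" using E_eq by auto
    qed
    have "g \<notin> cl P'" using cl_mono[OF PG] sub G_flat GL gkL by blast
    hence "r P' = r P - 1" using r_insert_notin_cl[of P' g] sb sub gkL gk unfolding P'_def
      by (simp add: insert_absorb subset_iff)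
    moreover have cP': "E - P' = insert g (insert f Q)" using cm gk sb unfolding P'_def by auto
    have "cl L \<subseteq> cl (insert f Q)" using gk gkL assms sb cl_ext[of L] cl_ext[of "insert f Q"] sub
      by (intro line_absorb[of _ f k]) auto
    hence "g \<in> cl (insert f Q)" using gkL cl_ext[of L] sub by auto
    hence "r (E - P') = r Q + 1" using cP' rQ by (simp add: cl_def)
    ultimately have "lam P' = 1" using lam_eq[of P'] sum sb unfolding P'_def by auto
    moreover have "2 \<le> card (E - P')"
    proof -
      have "{f,g} \<subseteq> E - P'" using cP' by auto
      thus ?thesis using card_mono[of "E - P'" "{f,g}"] gkL fin by simp
    qed
    ultimately have "card P' \<le> 1" using lam_small[of P'] sb unfolding P'_def by auto
    moreover have "card P' = card P - 1" using gk finite_sub[OF sb(1)] unfolding P'_def by simp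
    moreover have "3 \<le> card P" using D.card_ge_of_r[of P 3] S' sb by auto
    ultimately show False by simp
  qed
  moreover have "h \<in> P \<or> h \<in> Q" using \<open>separation3 E s P f Q\<close> sub assms hL
    by (auto simp: separation3_def)
  ultimately show False using separation3_sym by metis
qed

text \<open>A separation of \<open>f\<close> in normal form, with all the rest of the line on the side \<open>P\<close>, and \<open>P \<union> {f}\<close> closed.\<close>

definition flat_separation :: "'a set \<Rightarrow> 'a \<Rightarrow> 'a set \<Rightarrow> bool" where
  "flat_separation P f Q \<longleftrightarrow> f \<in> L \<and> separation3 E r P f Q \<and> cl P = insert f P \<and> cl L \<subseteq> insert f P"

text \<open>Some side contains a second element of the line. Together with \<open>f\<close> it spans the line, so closing that side
absorbs the line.\<close>

lemma flat_separation_exists: assumes "f \<in> L" "separation3 E r P f Q"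
  shows "\<exists>P Q. flat_separation P f Q"
proof -
  have *: "\<exists>P Q. flat_separation P f Q" if S: "separation3 E r P f Q" and x: "x \<in> P" "x \<in> L" for P Q x
  proof -
    note S' = S[unfolded separation3_def]
    have sb: "P \<subseteq> E" using S' by auto
    have f: "f \<in> cl P" using separation3_cl[OF S] by blast
    have Lc: "cl L \<subseteq> cl P"
      using x S' f assms cl_ext[OF sb] cl_ext[of L] sub by (intro line_absorb[of P x f] sb) auto
    have "cl (cl P - {f}) = cl P"
    proof
      have "cl P - {f} \<subseteq> cl P" by auto
      thus "cl (cl P - {f}) \<subseteq> cl P" by (rule cl_least[OF sb])
      have "P \<subseteq> cl P - {f}" using cl_ext[OF sb] S' by auto
      thus "cl P \<subseteq> cl (cl P - {f})" using cl_sub[of P] by (intro cl_mono) auto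
    qed
    moreover have "insert f (cl P - {f}) = cl P" using f by auto
    ultimately have "flat_separation (cl P - {f}) f (Q - cl P)"
      using separation3_close[OF S] assms Lc unfolding flat_separation_def by simp
    thus ?thesis by blast
  qed
  have "2 \<le> card (L - {f})" using cL assms finite_sub[OF sub(2)] by simp
  then obtain x y where "x \<in> L - {f}" "y \<in> L - {f}" "x \<noteq> y" by (rule two_elems)
  hence x: "x \<in> L" "x \<noteq> f" by auto
  hence "x \<in> P \<or> x \<in> Q" using assms sub by (auto simp: separation3_def)
  thus ?thesis using *[of P Q x] *[of Q P x] x assms separation3_sym by metis
qed

lemma notin_cl_G: "A \<subseteq> G \<Longrightarrow> x \<in> L \<Longrightarrow> x \<notin> cl A"
  using cl_mono[of A G] sub G_flat GL by blast

lemma other_line_point: assumes "f \<in> L" obtains g where "g \<in> L" "g \<noteq> f"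
proof -
  have "2 \<le> card (L - {f})" using cL assms finite_sub[OF sub(2)] by simp
  then obtain x y where "x \<in> L - {f}" "y \<in> L - {f}" "x \<noteq> y" by (rule two_elems)
  thus ?thesis using that by auto
qed

lemma line_meets_hyperplane_once: "card (cl L \<inter> G) \<le> 1"
proof (rule ccontr)
  assume "\<not> card (cl L \<inter> G) \<le> 1"
  hence "2 \<le> card (cl L \<inter> G)" by simp
  then obtain x y where "x \<in> cl L \<inter> G" "y \<in> cl L \<inter> G" "x \<noteq> y" by (rule two_elems)
  hence "cl L \<subseteq> cl G" using cl_ext[of G] sub by (intro line_absorb[of G x y]) auto
  hence "L \<subseteq> G" using cl_ext[of L] sub G_flat by auto
  hence "L = {}" using GL by auto
  thus False using cL by simp
qed

text \<open>The element \<open>h\<close> must lie in \<open>Q\<close>, since otherwise \<open>f\<close> would be in the closure of a subset of \<open>G\<close>. So \<open>P\<close> and \<open>Q\<close>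
consist of \<open>L - {f}\<close> and \<open>h\<close>, respectively, and of the traces on \<open>G\<close>; and as \<open>f\<close> is spanned by \<open>Q\<close> but not by its
trace, exchange puts \<open>h\<close> into the span of the trace and \<open>f\<close>.\<close>

lemma flat_separation_facts: assumes S: "flat_separation P f Q"
  shows "P \<subseteq> E" "Q \<subseteq> E" "f \<in> L" "f \<in> E" "f \<notin> P" "f \<notin> Q" "P \<inter> Q = {}" "E \<subseteq> insert f (P \<union> Q)"
    "cl L \<subseteq> insert f P" "cl P = insert f P"
    "r (insert f P) = r P" "r (insert f Q) = r Q" "r P + r Q = r E + 2" "3 \<le> r P" "3 \<le> r Q" "h \<in> Q"
    "L - {f} \<subseteq> P" "P \<subseteq> (L - {f}) \<union> G" "Q \<subseteq> insert h G" "h \<in> cl (insert f (Q \<inter> G))"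
    "r (Q \<inter> G) = r Q - 1"
proof -
  have S': "separation3 E r P f Q" and fL: "f \<in> L" and Lc: "cl L \<subseteq> insert f P"
    and cP: "cl P = insert f P"
    using S unfolding flat_separation_def by auto
  note D = S'[unfolded separation3_def]
  show sb: "P \<subseteq> E" "Q \<subseteq> E" and fE: "f \<in> E" using separation3_sub[OF S'] by auto
  show "f \<in> L" "cl L \<subseteq> insert f P" "cl P = insert f P" by fact+
  show f: "f \<notin> P" "f \<notin> Q" "P \<inter> Q = {}" and U: "E \<subseteq> insert f (P \<union> Q)"
    "r (insert f P) = r P" and rQ: "r (insert f Q) = r Q" and "r P + r Q = r E + 2" "3 \<le> r P" "3 \<le> r Q"
    using D by blast+
  have Lc': "L \<subseteq> insert f P" using Lc cl_ext[OF sub(2)] by blast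
  thus LP: "L - {f} \<subseteq> P" by blast
  show hQ: "h \<in> Q"
  proof (rule ccontr)
    assume "h \<notin> Q"
    hence "Q \<subseteq> G" using sb f LP E_eq by blast
    thus False using separation3_cl[OF S'] notin_cl_G fL by blast
  qed
  show "P \<subseteq> (L - {f}) \<union> G"
  proof
    fix x assume "x \<in> P"
    thus "x \<in> (L - {f}) \<union> G" using sb E_eq f hQ by auto
  qed
  show QhG: "Q \<subseteq> insert h G"
  proof
    fix x assume "x \<in> Q"
    thus "x \<in> insert h G" using sb E_eq f LP by auto
  qed
  have Q: "insert h (Q \<inter> G) = Q" using QhG hQ by auto
  have QG: "Q \<inter> G \<subseteq> E" "f \<notin> cl (Q \<inter> G)" using sb notin_cl_G[of "Q \<inter> G" f] fL by auto
  have fi: "f \<in> cl (insert h (Q \<inter> G))" using separation3_cl[OF S'] Q by simp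
  show "h \<in> cl (insert f (Q \<inter> G))" using cl_exchange[OF QG(1) _ fi QG(2)] sub by blast
  have "r (insert f (Q \<inter> G)) = r (Q \<inter> G) + 1" using r_insert_notin_cl QG fE by blast
  moreover have "r (insert f (Q \<inter> G)) \<le> r (insert f Q)" using sb fE by (intro r_mono) auto
  moreover have "r (insert h (Q \<inter> G)) \<le> r (Q \<inter> G) + 1" using r_step[OF QG(1), of h] sub by blast
  moreover have "r (insert h (Q \<inter> G)) = r Q" using Q by simp
  ultimately show "r (Q \<inter> G) = r Q - 1" using rQ by linarith
qed

lemma h_notin_cl: assumes S: "flat_separation P f Q" shows "h \<notin> cl P"
  using flat_separation_facts[OF S] hL by auto

text \<open>Here \<open>\<lambda>(P \<inter> G) \<ge> 2\<close> meets the bounds \<open>r(P \<inter> G) \<le> r(P) - 1\<close> and \<open>r(Q \<union> L) \<le> r(Q) + 1\<close>, whose sum is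
exactly \<open>r(E) + 2\<close>, so both bounds are attained.\<close>

lemma large_side: assumes S: "flat_separation P f Q" and c: "2 \<le> card (P \<inter> G)"
  shows "r (P \<inter> G) = r P - 1" "r (Q \<union> L) = r Q + 1"
proof -
  note F = flat_separation_facts[OF S]
  obtain g where g: "g \<in> L" "g \<noteq> f" using other_line_point F(3) by blast
  have PG: "P \<inter> G \<subseteq> E" using F by auto
  have "g \<notin> cl (P \<inter> G)" using notin_cl_G[of "P \<inter> G" g] g by auto
  hence "r (insert g (P \<inter> G)) = r (P \<inter> G) + 1" using PG g sub by (intro r_insert_notin_cl) auto
  moreover have "r (insert g (P \<inter> G)) \<le> r P" using g F by (intro r_mono) auto
  ultimately have 1: "r (P \<inter> G) + 1 \<le> r P" by simp
  have "cl L \<subseteq> cl (insert g (insert f Q))" using g F(2,3,4) sub cl_ext[of L] cl_ext[of "insert g (insert f Q)"]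
    by (intro line_absorb[of _ f g]) auto
  hence "L \<subseteq> cl (insert g (insert f Q))" using cl_ext[of L] sub by auto
  hence "r (insert g (insert f Q) \<union> L) = r (insert g (insert f Q))" using g F sub by (intro r_Un_cl) auto
  moreover have "insert g (insert f Q) \<union> L = Q \<union> L" using g F by auto
  moreover have "r (insert g (insert f Q)) \<le> r (insert f Q) + 1" using r_step[of "insert f Q" g] F g sub by auto
  ultimately have 2: "r (Q \<union> L) \<le> r Q + 1" using F by simp
  have "x \<in> E - (P \<inter> G) \<longleftrightarrow> x \<in> Q \<union> L" for x
    using F(2,3,5-8,18) GL sub(1,2) by (cases "x = f") blast+
  hence E: "E - (P \<inter> G) = Q \<union> L" by blast
  have "2 \<le> card (E - (P \<inter> G))"
    using F cL card_mono[of "Q \<union> L" L] E finite_sub[of "Q \<union> L"] sub by auto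
  hence "2 \<le> lam (P \<inter> G)" using conn2[of "P \<inter> G"] c PG by blast
  hence "r (P \<inter> G) + r (Q \<union> L) \<ge> r E + 2" using lam_eq[OF PG] E by simp
  thus "r (P \<inter> G) = r P - 1" "r (Q \<union> L) = r Q + 1" using 1 2 F(13) by auto
qed

text \<open>If \<open>P \<inter> G\<close> has at most one element, \<open>Q \<union> L\<close> contains all elements but one and therefore spans, which \<open>Q\<close> does not.\<close>

lemma line_not_in_cl_Q: assumes S: "flat_separation P f Q" shows "r Q < r (Q \<union> L)"
proof (cases "2 \<le> card (P \<inter> G)")
  case True thus ?thesis using large_side[OF S] by simp
next
  case False
  note F = flat_separation_facts[OF S]
  have "finite (P \<inter> G)" "card (P \<inter> G) \<le> Suc 0" using False finite_sub[OF F(1)] by auto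
  then obtain z where "P \<inter> G \<subseteq> {z}" using card_le_Suc0_iff_eq[of "P \<inter> G"] by blast
  moreover have "E \<subseteq> Q \<union> L \<union> (P \<inter> G)" using F(3,8,18) by auto
  ultimately have "E - {z} \<subseteq> Q \<union> L" by blast
  hence "r (E - {z}) \<le> r (Q \<union> L)" using F(2) sub by (intro r_mono) auto
  moreover have "r (E - {z}) = r E" using r_del1[of z] by (cases "z \<in> E") auto
  ultimately show ?thesis using F(13,14) by simp
qed

lemma side_nonempty: assumes S: "flat_separation P f Q" shows "\<not> P \<inter> G \<subseteq> cl L"
proof
  assume "P \<inter> G \<subseteq> cl L"
  moreover have "P \<subseteq> L \<union> (P \<inter> G)" using flat_separation_facts(18)[OF S] by auto
  ultimately have "P \<subseteq> cl L" using cl_ext[OF sub(2)] by auto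
  hence "r P \<le> 2" using r_sub_cl[OF sub(2), of P] rL by simp
  thus False using flat_separation_facts[OF S] by simp
qed

context
  fixes P1 f1 Q1 P2 f2 Q2
  assumes S1: "flat_separation P1 f1 Q1" and S2: "flat_separation P2 f2 Q2" and ne: "f1 \<noteq> f2"
begin

lemmas F1 = flat_separation_facts[OF S1]
lemmas F2 = flat_separation_facts[OF S2]

text \<open>If the traces of \<open>Q1\<close> and \<open>Q2\<close> were disjoint, then \<open>P2\<close> would contain \<open>f1\<close> and the trace of \<open>Q1\<close>, which span \<open>h\<close>.\<close>

lemma other_sides_meet: "Q1 \<inter> Q2 \<inter> G \<noteq> {}"
proof
  assume "Q1 \<inter> Q2 \<inter> G = {}"
  hence "Q1 \<inter> G \<subseteq> P2" using F1(2) F2(3,8) GL by blast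
  moreover have "f1 \<in> P2" using ne F1(3) F2(17) by blast
  ultimately have "insert f1 (Q1 \<inter> G) \<subseteq> P2" by blast
  hence "h \<in> cl P2" using F1(20) cl_mono[OF _ F2(1)] by blast
  thus False using h_notin_cl[OF S2] by blast
qed

text \<open>With \<open>Y = P1 \<inter> P2 \<inter> G\<close> and \<open>C = Q1 \<inter> Q2\<close>, submodularity for the flats \<open>P\<^sub>i \<union> {f\<^sub>i}\<close> and for the sets \<open>Q\<^sub>i \<union> {f\<^sub>i}\<close>,
together with \<open>\<lambda>(C) \<ge> 2\<close>, bounds \<open>r(L \<union> Y)\<close>. The element \<open>f1\<close> is spanned by the complement of \<open>Y\<close> but not by
\<open>Y\<close> itself, so the bound gives \<open>\<lambda>(Y) \<le> 1\<close>. Hence \<open>Y\<close> is empty or a single element, and in the second case the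
same bound reads \<open>r(L \<union> Y) \<le> 2\<close>.\<close>

lemma sides_meet_in_line: "P1 \<inter> P2 \<inter> G \<subseteq> cl L"
proof -
  define K1 K2 R1 R2 C Y where defs: "K1 = insert f1 P1" "K2 = insert f2 P2" "R1 = insert f1 Q1" "R2 = insert f2 Q2"
    "C = Q1 \<inter> Q2" "Y = P1 \<inter> P2 \<inter> G"
  have f: "f1 \<in> P2" "f2 \<in> P1" using ne F1(3,17) F2(3,17) by auto
  have sb: "K1 \<subseteq> E" "K2 \<subseteq> E" "R1 \<subseteq> E" "R2 \<subseteq> E" "C \<subseteq> E" "Y \<subseteq> E" using F1(1,2,4) F2(1,2,4) unfolding defs by auto
  have KK: "K1 \<inter> K2 = L \<union> Y" using F1(3,17,18) F2(3,17,18) f GL unfolding defs by blast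
  have RR: "R1 \<inter> R2 = C" using f F1(7) F2(7) ne unfolding defs by auto
  have EC: "E - C = K1 \<union> K2" using F1(1,4-8) F2(1,4-8) f unfolding defs by auto
  have EY: "E - Y = (R1 \<union> R2) \<union> L"
  proof
    show "E - Y \<subseteq> (R1 \<union> R2) \<union> L"
    proof
      fix x assume "x \<in> E - Y"
      thus "x \<in> (R1 \<union> R2) \<union> L" using F1(8,18) F2(8,18) unfolding defs by auto
    qed
    have "x \<in> E - Y" if "x \<in> R1 \<union> R2 \<union> L" for x
      using that F1(2-7) F2(2-7) GL sub(2) unfolding defs by auto
    thus "(R1 \<union> R2) \<union> L \<subseteq> E - Y" by auto
  qed
  have "L \<subseteq> cl (R1 \<union> R2)"
  proof -
    have "cl L \<subseteq> cl (R1 \<union> R2)" using F1(3) F2(3) sub sb ne cl_ext[of L] cl_ext[of "R1 \<union> R2"] unfolding defs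
      by (intro line_absorb[of _ f1 f2]) auto
    thus ?thesis using cl_ext[of L] sub by auto
  qed
  hence rR: "r ((R1 \<union> R2) \<union> L) = r (R1 \<union> R2)" using sb by (intro r_Un_cl) auto
  have "h \<in> C" using F1(16) F2(16) unfolding defs by auto
  moreover obtain x where "x \<in> C" "x \<in> G" using other_sides_meet unfolding defs by blast
  ultimately have "{h,x} \<subseteq> C" "h \<noteq> x" using hG by auto
  hence c2: "2 \<le> card C" using card_mono[OF finite_sub[OF sb(5)], of "{h,x}"] by simp
  moreover have "L \<subseteq> K1 \<union> K2" using KK by auto
  hence "2 \<le> card (E - C)" using EC card_mono[of "K1 \<union> K2" L] sb finite_sub cL by fastforce
  ultimately have "2 \<le> lam C" using conn2 sb by blast
  hence rC: "r C + r (K1 \<union> K2) \<ge> r E + 2" using lam_eq[OF sb(5)] EC by simp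
  have "r (K1 \<union> K2) + r (L \<union> Y) \<le> r K1 + r K2" using r_submod[OF sb(1,2)] KK by simp
  moreover have "r (R1 \<union> R2) + r C \<le> r R1 + r R2" using r_submod[OF sb(3,4)] RR by simp
  moreover have "r K1 + r R1 = r E + 2" "r K2 + r R2 = r E + 2" using F1(11-13) F2(11-13) unfolding defs by auto
  ultimately have key: "r (L \<union> Y) + r (R1 \<union> R2) \<le> r E + 2" using rC by linarith
  have lY: "lam Y = r Y + r (R1 \<union> R2) - r E" using lam_eq[OF sb(6)] EY rR by simp
  have fY: "r (insert f1 Y) = r Y + 1" using notin_cl_G[of Y f1] F1(3) sb sub unfolding defs
    by (intro r_insert_notin_cl) auto
  have "r (insert f1 Y) \<le> r (L \<union> Y)" using F1(3) sb sub by (intro r_mono) auto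
  hence "lam Y \<le> 1" using lY key fY by linarith
  moreover have "2 \<le> card (E - Y)" using EY cL card_mono[of "(R1 \<union> R2) \<union> L" L] finite_sub[of "(R1 \<union> R2) \<union> L"] sb sub by auto
  ultimately have "card Y \<le> 1" using lam_small sb by blast
  show ?thesis
  proof (cases "Y = {}")
    case False
    then obtain y where y: "Y = {y}" using \<open>card Y \<le> 1\<close> finite_sub[OF sb(6)]
      by (metis One_nat_def card_1_singletonE card_0_eq le_Suc_eq le_zero_eq)
    have "lam Y = 1" "r Y = 1" using lam_single[of y] r_single[of y] sb y by auto
    hence "r (L \<union> Y) \<le> 2" using lY key by linarith
    moreover have "2 \<le> r L" using r_ge2[of L f1 f2] F1(3) F2(3) sub ne by auto
    ultimately have "y \<in> cl L" using y sb sub by (intro in_clI[of L "L \<union> Y"]) auto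
    thus ?thesis using y unfolding defs by auto
  qed (auto simp: defs)
qed

text \<open>Let \<open>A\<close> be the part of the trace of \<open>P1\<close> off the line, and suppose that it has two elements. Then \<open>\<lambda>(A) \<ge> 2\<close>
shows that \<open>A\<close> has the full rank of the trace, so adding the line to \<open>A\<close> raises its rank by one only. As \<open>A\<close>
is contained in \<open>Q2 \<inter> G\<close>, the same is true of \<open>Q2 \<inter> G\<close>. But \<open>Q2\<close> already exceeds \<open>Q2 \<inter> G\<close> by one in rank, and
so the line would be in its span, contrary to \<open>line_not_in_cl_Q\<close>.\<close>

lemma at_most_one_off_line: "card (P1 \<inter> G - cl L) \<le> 1"
proof (rule ccontr)
  let ?A = "P1 \<inter> G - cl L"
  assume "\<not> ?thesis"
  hence c: "2 \<le> card ?A" by simp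
  have AE: "?A \<subseteq> E" using F1(1) by auto
  have "?A \<subseteq> Q2 \<inter> G" using sides_meet_in_line F2(3,8) F1(1) GL by blast
  have PGE: "P1 \<inter> G \<subseteq> E" using F1(1) by auto
  have "card ?A \<le> card (P1 \<inter> G)" using finite_sub[OF PGE] by (intro card_mono) auto
  hence c1: "2 \<le> card (P1 \<inter> G)" using c by simp
  note B = large_side[OF S1 c1]
  have Lc: "cl L \<subseteq> E" by (rule cl_sub)
  have EA: "E - ?A = (Q1 \<union> L) \<union> cl L"
  proof (rule set_eqI)
    fix x
    have "x \<in> P1 \<Longrightarrow> x \<in> L \<or> x \<in> G" "x \<in> L \<Longrightarrow> x \<in> cl L" "x \<in> E \<Longrightarrow> x = f1 \<or> x \<in> P1 \<or> x \<in> Q1"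
      using F1(8,18) cl_ext[OF sub(2)] by auto
    moreover have "x \<in> Q1 \<Longrightarrow> x \<in> E \<and> x \<notin> P1" "x \<in> cl L \<Longrightarrow> x \<in> E" "f1 \<in> L" using F1(2,3,7) Lc by auto
    ultimately show "x \<in> E - ?A \<longleftrightarrow> x \<in> (Q1 \<union> L) \<union> cl L" by auto
  qed
  have "cl L \<subseteq> cl (Q1 \<union> L)" using F1(2) sub by (intro cl_mono) auto
  hence "r (E - ?A) = r Q1 + 1" using EA B r_Un_cl[of "Q1 \<union> L" "cl L"] F1(2) sub by auto
  moreover have "2 \<le> card (E - ?A)"
  proof -
    have "L \<subseteq> E - ?A" "finite (E - ?A)" using EA fin by blast+
    hence "card L \<le> card (E - ?A)" by (rule card_mono[rotated])
    thus ?thesis using cL by simp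
  qed
  ultimately have "r ?A \<ge> r E + 1 - r Q1" using conn2[OF AE c] lam_eq[OF AE] by simp
  hence rA: "r (P1 \<inter> G) \<le> r ?A" using B F1(13) by simp
  hence clA: "P1 \<inter> G \<subseteq> cl ?A" using PGE by (auto intro!: in_clI[of ?A "P1 \<inter> G"])
  have Q2G: "Q2 \<inter> G \<subseteq> E" using F2(2) by auto
  have "r (?A \<union> L) \<le> r P1"
  proof -
    have "?A \<union> L \<subseteq> insert f1 P1" using F1(17) by auto
    hence "r (?A \<union> L) \<le> r (insert f1 P1)" using F1(1,4) by (intro r_mono) auto
    thus ?thesis using F1(11) by simp
  qed
  hence AL: "r (?A \<union> L) \<le> r ?A + 1" using rA B by simp
  have "r ((?A \<union> L) \<union> (Q2 \<inter> G)) + r ((?A \<union> L) \<inter> (Q2 \<inter> G)) \<le> r (?A \<union> L) + r (Q2 \<inter> G)"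
    using AE sub Q2G by (intro r_submod) auto
  moreover have "(?A \<union> L) \<union> (Q2 \<inter> G) = (Q2 \<inter> G) \<union> L" "(?A \<union> L) \<inter> (Q2 \<inter> G) = ?A"
    using \<open>?A \<subseteq> Q2 \<inter> G\<close> GL by auto
  ultimately have *: "r ((Q2 \<inter> G) \<union> L) \<le> r Q2" using AL F2(21) by simp
  have "insert f2 (Q2 \<inter> G) \<subseteq> (Q2 \<inter> G) \<union> L" using F2(3) by auto
  hence "h \<in> cl ((Q2 \<inter> G) \<union> L)" using F2(20) cl_mono[of "insert f2 (Q2 \<inter> G)" "(Q2 \<inter> G) \<union> L"] Q2G sub by auto
  hence "r (insert h ((Q2 \<inter> G) \<union> L)) \<le> r Q2" using * by (simp add: cl_def)
  moreover have "insert h ((Q2 \<inter> G) \<union> L) = Q2 \<union> L" using F2(16,19) by auto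
  ultimately show False using line_not_in_cl_Q[OF S2] by simp
qed

end

text \<open>With one element \<open>z\<close> off the line, the side \<open>P1\<close> is the closure of the line with \<open>z\<close> added and \<open>f1\<close> removed, and
its complement \<open>Q1 \<union> {f1}\<close> does not span.\<close>

lemma cocircuit_partner:
  assumes S1: "flat_separation P1 f1 Q1" and S2: "flat_separation P2 f2 Q2" and ne: "f1 \<noteq> f2"
  obtains z where "z \<in> P1 \<inter> G" "z \<notin> cl L" "r (E - insert z ((L \<union> cl L \<inter> G) - {f1})) < r E"
proof -
  note F1 = flat_separation_facts[OF S1]
  have fin': "finite (P1 \<inter> G - cl L)" using finite_sub[OF F1(1)] by simp
  obtain z where z: "P1 \<inter> G - cl L = {z}"
    using at_most_one_off_line[OF S1 S2 ne] side_nonempty[OF S1] fin'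
    by (metis Diff_eq_empty_iff One_nat_def card_1_singletonE card_0_eq le_Suc_eq le_zero_eq)
  have eq: "E - insert z ((L \<union> cl L \<inter> G) - {f1}) = insert f1 Q1"
  proof (rule set_eqI)
    fix x
    have "z \<in> P1" "z \<noteq> f1" and zx: "x \<in> P1 \<Longrightarrow> x \<in> G \<Longrightarrow> x \<notin> cl L \<Longrightarrow> x = z"
      using z F1(5) by auto
    moreover have "x \<in> cl L \<Longrightarrow> x = f1 \<or> x \<in> P1" "x \<in> L \<Longrightarrow> x \<in> cl L"
      using F1(9) cl_ext[OF sub(2)] by auto
    moreover have "x \<in> P1 \<Longrightarrow> x \<in> L \<or> x \<in> G" "x \<in> E \<Longrightarrow> x = f1 \<or> x \<in> P1 \<or> x \<in> Q1"
      using F1(8,18) by auto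
    moreover have "x \<in> Q1 \<Longrightarrow> x \<in> E \<and> x \<notin> P1 \<and> x \<noteq> f1" "f1 \<in> E" using F1(2,4,6,7) by auto
    ultimately show "x \<in> E - insert z ((L \<union> cl L \<inter> G) - {f1}) \<longleftrightarrow> x \<in> insert f1 Q1" by auto
  qed
  show ?thesis
  proof (rule that[of z])
    show "r (E - insert z ((L \<union> cl L \<inter> G) - {f1})) < r E"
      using eq F1(12-14) by simp
  qed (use z in auto)
qed

text \<open>Otherwise each blocked element of \<open>L\<close> has a partner by comparison with another blocked one. If the line has
an element in \<open>G\<close>, its partner is \<open>h\<close>, since \<open>L \<union> {h}\<close> is the complement of \<open>G\<close>. The closure \<open>W\<close> of the line
then carries a \<open>\<Theta>\<close>-configuration, unless it is a triangle; but then a blocked element of \<open>L\<close>, the other two and the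
partner form a fan.\<close>

lemma two_unblocked_on_line: "2 \<le> card {f \<in> L. \<not> blocked f}"
proof (rule ccontr)
  assume "\<not> 2 \<le> card {f \<in> L. \<not> blocked f}"
  hence few: "card {f \<in> L. \<not> blocked f} \<le> 1" by simp
  define U where "U = {f \<in> L. blocked f}"
  have finL: "finite L" using finite_sub sub by blast
  have "L = U \<union> {f \<in> L. \<not> blocked f}" unfolding U_def by auto
  hence "card L \<le> card U + card {f \<in> L. \<not> blocked f}" using card_Un_le by metis
  hence cU: "card L \<le> card U + 1" using few by simp
  have finU: "finite U" using finL unfolding U_def by simp
  have "\<forall>f\<in>U. \<exists>P Q. flat_separation P f Q"
    using not_dual_blocked flat_separation_exists unfolding U_def blocked_def by blast
  then obtain P Q where S: "\<And>f. f \<in> U \<Longrightarrow> flat_separation (P f) f (Q f)" by metis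
  have other: "\<exists>g\<in>U. g \<noteq> f" for f
  proof (rule ccontr)
    assume "\<not> ?thesis"
    hence "U \<subseteq> {f}" by auto
    hence "card U \<le> 1" using card_mono[of "{f}" U] by simp
    thus False using cU cL by simp
  qed
  \<comment> \<open>\<open>T\<close> is empty or consists of the element of the closure of the line in \<open>G\<close>.\<close>
  define T where "T = cl L \<inter> G"
  define W where "W = L \<union> T"
  have "\<forall>f\<in>U. \<exists>z. z \<in> P f \<inter> G \<and> z \<notin> cl L \<and> r (E - insert z (W - {f})) < r E"
  proof
    fix f assume f: "f \<in> U"
    then obtain g where "g \<in> U" "g \<noteq> f" using other by blast
    thus "\<exists>z. z \<in> P f \<inter> G \<and> z \<notin> cl L \<and> r (E - insert z (W - {f})) < r E"
      using cocircuit_partner[OF S[OF f] S[of g]] unfolding W_def T_def by metis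
  qed
  then obtain z0 where z0: "\<And>f. f \<in> U \<Longrightarrow> z0 f \<in> P f \<inter> G" "\<And>f. f \<in> U \<Longrightarrow> z0 f \<notin> cl L"
    "\<And>f. f \<in> U \<Longrightarrow> r (E - insert (z0 f) (W - {f})) < r E" by metis
  obtain f1 where f1: "f1 \<in> U" using other by blast
  note F = flat_separation_facts[OF S[OF f1]]
  have cT: "card T \<le> 1"
    using line_meets_hyperplane_once unfolding T_def .
  have finT: "finite T" using finite_sub[of T] sub unfolding T_def by blast
  have LT: "L \<inter> T = {}" using GL unfolding T_def by auto
  have Wcl: "W \<subseteq> cl L" using cl_ext[OF sub(2)] unfolding W_def T_def by auto
  have WE: "W \<subseteq> E" using Wcl cl_sub by blast
  have rW: "r W \<le> 2" using r_sub_cl[OF sub(2) Wcl] rL by simp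
  have cW: "card W = card L + card T" unfolding W_def using LT finL finT by (simp add: card_Un_disjoint)
  have "4 \<le> r E" using F(13-15) by simp
  have hW: "h \<notin> W" using hL hG unfolding W_def T_def by auto
  define z where "z f = (if f \<in> U then z0 f else h)" for f
  define B where "B = U \<union> T"
  have UL: "U \<subseteq> L" unfolding U_def by auto
  have cB: "card B = card U + card T" unfolding B_def using LT UL finU finT by (subst card_Un_disjoint) auto
  have zU: "z f \<in> E - W" "z f \<noteq> h" if "f \<in> U" for f
    using z0(1,2)[OF that] Wcl that hG sub unfolding z_def by auto
  have inj: "inj_on z B"
  proof (rule inj_onI)
    fix f g assume fg: "f \<in> B" "g \<in> B" "z f = z g"
    consider "f \<in> U" "g \<in> U" | "f \<in> U" "g \<notin> U" | "f \<notin> U" "g \<in> U" | "f \<notin> U" "g \<notin> U" by blast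
    thus "f = g"
    proof cases
      case 1
      show ?thesis
      proof (rule ccontr)
        assume ne: "f \<noteq> g"
        have "z0 f = z0 g" using fg 1 by (simp add: z_def)
        hence "z0 f \<in> P f \<inter> P g \<inter> G" using z0(1)[OF 1(1)] z0(1)[OF 1(2)] by auto
        thus False using sides_meet_in_line[OF S[OF 1(1)] S[OF 1(2)] ne] z0(2)[OF 1(1)] by blast
      qed
    next
      case 4
      thus ?thesis using cT finT fg card_le_Suc0_iff_eq[of T] unfolding B_def by auto
    qed (use zU fg in \<open>auto simp: z_def\<close>)
  qed
  have small: "r (E - insert (z f) (W - {f})) < r E" if "f \<in> B" for f
  proof (cases "f \<in> U")
    case True thus ?thesis using z0(3) by (simp add: z_def)
  next
    case False
    hence fT: "f \<in> T" using that unfolding B_def by simp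
    have "T \<subseteq> {f}" using card_le_Suc0_iff_eq[OF finT] cT fT by auto
    hence "E - insert (z f) (W - {f}) = G"
      using False fT E_eq hG GL unfolding W_def z_def T_def by auto
    thus ?thesis using rG by simp
  qed
  have c4: "4 \<le> card W"
  proof (rule ccontr)
    assume "\<not> 4 \<le> card W"
    hence c: "card L = 3" "card T = 0" using cW cL by auto
    hence WL: "W = L" using finT unfolding W_def by simp
    have f1L: "f1 \<in> L" using f1 UL by blast
    have "card (L - {f1}) = 2" using c f1L finL by simp
    then obtain a b where ab: "L - {f1} = {a,b}" "a \<noteq> b" by (auto simp: card_2_iff)
    have L3: "L = {f1,a,b}" using ab f1L by auto
    have zf: "z f1 \<in> E - L" using zU[OF f1] WL by simp
    have abL: "a \<in> L" "b \<in> L" "a \<noteq> f1" "b \<noteq> f1" using ab(1) by auto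
    have abE: "a \<in> E" "b \<in> E" "f1 \<in> E" using abL f1L sub by auto
    have nef: "f1 \<noteq> a" "f1 \<noteq> b" "z f1 \<noteq> f1" "z f1 \<noteq> a" "z f1 \<noteq> b" using abL f1L zf by auto
    have "r (E - {z f1, a, b}) < r E" using small[of f1] f1 WL ab unfolding B_def by simp
    moreover have "card {a, b, z f1} = 3" using nef ab(2) by auto
    moreover have ie: "{z f1, a, b} = {a, b, z f1}" by auto
    ultimately have s2: "s {a, b, z f1} \<le> 2" using s_eq[of "{a, b, z f1}"] zf abE by simp
    have d: "distinct [f1, a, b, z f1]" using nef ab(2) by simp
    have "{f1, a, b, z f1} \<subseteq> E" using zf abE by simp
    moreover have "r {f1, a, b} \<le> 2" using rL L3 by simp
    ultimately show False using no_fan[OF d _ _ s2] by blast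
  qed
  have "theta_configuration E r"
    unfolding theta_configuration_def
  proof (rule exI[of _ W], rule exI[of _ B], rule exI[of _ z], intro conjI ballI)
    show "B \<subseteq> W" unfolding B_def W_def using UL by auto
    show "card W \<le> card B + 1" using cW cB cU by simp
    show "z ` B \<subseteq> E - W" using zU sub hW unfolding z_def by auto
  qed (use WE rW c4 inj small \<open>4 \<le> r E\<close> in auto)
  thus False using no_theta by blast
qed

end

context tame_pair begin

text \<open>Let \<open>G\<close> be the closure of what remains without \<open>L\<close> and \<open>h\<close>. It is a hyperplane, because the complement of \<open>L\<close> spans
and \<open>h\<close> is a coloop of it. It contains at most one element of \<open>L\<close>, and if \<open>L - G\<close> had only two elements, these
would form a triad with \<open>h\<close> and a triangle with the third element of \<open>L\<close>.\<close>

lemma two_unblocked_on_coclosed_line: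
  assumes L: "L \<subseteq> E" "r L \<le> 2" "3 \<le> card L" and h: "h \<in> E - L" "s (insert h L) = s L"
    and rest: "2 \<le> card (E - L)"
  shows "2 \<le> card {f \<in> L. \<not> blocked f}"
proof -
  define F where "F = E - insert h L"
  have FE: "F \<subseteq> E" unfolding F_def by auto
  have EL: "E - L = insert h F" using h unfolding F_def by auto
  have lL: "2 \<le> lam L" using conn2[of L] L rest by auto
  have rEL: "r (E - L) = r F + 1" using s_insert_iff[of L h] L h unfolding F_def by auto
  have "r (E - L) \<le> r E" by (intro r_mono) auto
  moreover have "r (E - L) \<ge> r E" using lL lam_eq[of L] L by simp
  ultimately have rF: "r F = r E - 1" using rEL by simp
  define G where "G = cl F"
  have G: "G \<subseteq> E" "F \<subseteq> G" "r G = r E - 1" "cl G = G"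
    using cl_sub[of F] cl_ext[OF FE] r_cl[OF FE] rF cl_least[OF FE, of "cl F"] cl_ext[of "cl F"]
    unfolding G_def by auto
  have hG: "h \<notin> G" using rEL EL unfolding G_def by (auto simp: cl_def)
  have E1: "E = insert h (G \<union> (L - G))" using G h L unfolding F_def by auto
  have finL: "finite L" using finite_sub L by blast
  have one: "card (L \<inter> G) \<le> 1"
  proof (rule ccontr)
    assume "\<not> card (L \<inter> G) \<le> 1"
    hence "2 \<le> card (L \<inter> G)" by simp
    then obtain x y where xy: "x \<in> L \<inter> G" "y \<in> L \<inter> G" "x \<noteq> y" by (rule two_elems)
    have "L \<subseteq> cl {x,y}" using xy L by (intro line_cl) auto
    also have "\<dots> \<subseteq> cl G" using xy G by (intro cl_mono) auto
    finally have "E - {h} \<subseteq> G" using E1 G by auto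
    hence "r (E - {h}) \<le> r G" using G by (intro r_mono) auto
    thus False using r_del1[of h] h G by simp
  qed
  have "card (L \<inter> G) + card (L - G) = card L"
    using finL card_Int_Diff[of L G] by simp
  hence c2: "2 \<le> card (L - G)" using one L by simp
  have rLG: "r (L - G) \<le> 2" using r_mono[of "L - G" L] L by auto
  have c3: "3 \<le> card (L - G)"
  proof (rule ccontr)
    assume "\<not> 3 \<le> card (L - G)"
    hence c: "card (L - G) = 2" using c2 by simp
    then obtain a b where ab: "L - G = {a,b}" "a \<noteq> b" by (auto simp: card_2_iff)
    have "card (L \<inter> G) > 0" using \<open>card (L \<inter> G) + card (L - G) = card L\<close> c L by simp
    then obtain x where x: "x \<in> L" "x \<in> G" by (auto simp: card_gt_0_iff)
    have mem: "a \<in> L" "b \<in> L" "a \<in> E" "b \<in> E" "x \<in> E" "h \<in> E" "x \<noteq> a" "x \<noteq> b" "h \<noteq> a" "h \<noteq> b" "h \<noteq> x"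
      using ab x L h by auto
    have "x \<in> E - {a,b,h} \<longleftrightarrow> x \<in> G" for x
    proof -
      have "x \<in> E \<longleftrightarrow> x = h \<or> x \<in> G \<or> x \<in> {a,b}" using E1 ab by auto
      moreover have "{a,b} \<inter> G = {}" using ab by blast
      ultimately show ?thesis using hG by auto
    qed
    hence "E - {a,b,h} = G" by blast
    moreover have "card {a,b,h} = 3" using mem ab by simp
    ultimately have "s {a,b,h} \<le> 2" using s_eq[of "{a,b,h}"] mem G by simp
    moreover have "r {x,a,b} \<le> 2" using r_mono[of "{x,a,b}" L] L x mem by auto
    ultimately show False using no_fan[of x a b h] mem ab by auto
  qed
  interpret line_and_hyperplane E r s G "L - G" h
    using E1 hG h G rLG c3 by unfold_locales auto
  have "card {f \<in> L - G. \<not> blocked f} \<le> card {f \<in> L. \<not> blocked f}"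
    using finL by (intro card_mono) auto
  thus ?thesis using two_unblocked_on_line by simp
qed

end

section \<open>Uncrossing and the two elastic elements in a side\<close>

definition line_pair :: "('a set \<Rightarrow> int) \<Rightarrow> 'a set \<Rightarrow> 'a \<Rightarrow> 'a set \<Rightarrow> 'a set \<Rightarrow> bool" where
  "line_pair r X f L1 L2 \<longleftrightarrow> X = L1 \<union> L2 \<and> f \<in> L1 \<and> f \<in> L2 \<and> r L1 \<le> 2 \<and> r L2 \<le> 2"

lemma line_pair_sym: "line_pair r X f L1 L2 \<Longrightarrow> line_pair r X f L2 L1"
  by (auto simp: line_pair_def)

context tame_pair begin

abbreviation num_unblocked :: "'a set \<Rightarrow> nat" where
  "num_unblocked X \<equiv> card {f \<in> X. \<not> blocked f}"

lemma num_unblocked_mono: "X \<subseteq> Y \<Longrightarrow> Y \<subseteq> E \<Longrightarrow> num_unblocked X \<le> num_unblocked Y"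
  using finite_sub[of Y] by (intro card_mono) auto

text \<open>Submodularity for \<open>X\<close> and each of \<open>P\<close> and \<open>P \<union> {f}\<close>, whose unions with \<open>X\<close> coincide and have \<open>\<lambda> \<ge> 2\<close>, gives
\<open>\<lambda> \<le> 2\<close> for \<open>X \<inter> P\<close> with and without \<open>f\<close>. Since \<open>f\<close> is in the closure of \<open>Q\<close>, adding \<open>f\<close> changes \<open>\<lambda>\<close> by the
change of rank, so that \<open>f\<close> is spanned by \<open>X \<inter> P\<close> unless this set has at most one element.\<close>

lemma corner:
  assumes S: "separation3 E r P f Q" and X: "X \<subseteq> E" "lam X = 2" "f \<in> X" and c: "2 \<le> card (Q - X)"
  shows "separation3 E r (X \<inter> P) f (E - insert f (X \<inter> P)) \<or> r (insert f (X \<inter> P)) \<le> 2"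
    and "2 \<le> card (X \<inter> P) \<Longrightarrow> f \<in> cl (X \<inter> P)"
proof -
  have S': "f \<notin> P" "f \<notin> Q" "P \<inter> Q = {}" "3 \<le> r P" "3 \<le> r Q" "r P + r Q = r E + 2"
    and U: "E \<subseteq> insert f (P \<union> Q)"
    using S unfolding separation3_def by blast+
  have sb: "P \<subseteq> E" "Q \<subseteq> E" "f \<in> E" using separation3_sub[OF S] by auto
  define I where "I = X \<inter> P"
  have IE: "I \<subseteq> E" "insert f I \<subseteq> E" "f \<notin> I" using sb S' unfolding I_def by auto
  have "E - (X \<union> P) = Q - X" using U X S' sb by auto
  moreover have "2 \<le> card (X \<union> P)"
  proof -
    have "3 \<le> card P" using card_ge_of_r[of P 3] S' sb by auto
    also have "\<dots> \<le> card (X \<union> P)" using X sb finite_sub by (intro card_mono) auto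
    finally show ?thesis by simp
  qed
  ultimately have u: "2 \<le> lam (X \<union> P)" using conn2[of "X \<union> P"] c X sb by auto
  have "lam (X \<union> insert f P) + lam (X \<inter> insert f P) \<le> 4"
    using lam_submod[of X "insert f P"] X sb separation3_lam[OF S] by auto
  moreover have "X \<union> insert f P = X \<union> P" "X \<inter> insert f P = insert f I" using X unfolding I_def by auto
  ultimately have lf: "lam (insert f I) \<le> 2" using u by simp
  have QI: "Q \<subseteq> E - insert f I" using S' sb unfolding I_def by auto
  have "f \<in> cl (E - insert f I)" using cl_mono[OF QI] separation3_cl[OF S] by auto
  moreover have "insert f (E - insert f I) = E - I" using IE by auto
  ultimately have rc: "r (E - I) = r (E - insert f I)" by (auto simp: cl_def)
  have rQI: "3 \<le> r (E - insert f I)" using r_mono[OF QI] S' by auto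
  have fcl: "f \<in> cl I" and l2: "lam I = 2" if c2: "2 \<le> card I"
  proof -
    have "card Q \<le> card (E - I)" using QI fin by (intro card_mono) auto
    moreover have "3 \<le> card Q" using card_ge_of_r[of Q 3] S' sb by auto
    ultimately have "2 \<le> lam I" using conn2[of I] c2 IE by auto
    moreover have "lam I = r I + r (E - insert f I) - r E" using lam_eq[OF IE(1)] rc by simp
    moreover have "lam (insert f I) = r (insert f I) + r (E - insert f I) - r E" using lam_eq[OF IE(2)] .
    moreover have "r I \<le> r (insert f I)" using r_step[OF IE(1) sb(3)] by simp
    ultimately have "r (insert f I) = r I" "lam I = 2" using lf by auto
    thus "f \<in> cl I" "lam I = 2" using sb by (auto simp: cl_def)
  qed
  show "2 \<le> card (X \<inter> P) \<Longrightarrow> f \<in> cl (X \<inter> P)" using fcl unfolding I_def .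
  have "separation3 E r I f (E - insert f I) \<or> r (insert f I) \<le> 2"
  proof (cases "2 \<le> card I")
    case True
    have ri: "r (insert f I) = r I" using fcl[OF True] by (simp add: cl_def)
    show ?thesis
    proof (cases "3 \<le> r I")
      case 3: True
      have "insert f (E - insert f I) = E - I" "E = insert f (I \<union> (E - insert f I))" using IE by auto
      moreover have "r I + r (E - insert f I) = r E + 2" using l2[OF True] lam_eq[OF IE(1)] rc by simp
      ultimately show ?thesis using 3 ri rc rQI IE unfolding separation3_def by auto
    qed (use ri in auto)
  next
    case False
    have "card (insert f I) \<le> 2" using False finite_sub[OF IE(1)] by (simp add: card_insert_if)
    thus ?thesis using r_le_card[OF IE(2)] by simp
  qed
  thus "separation3 E r (X \<inter> P) f (E - insert f (X \<inter> P)) \<or> r (insert f (X \<inter> P)) \<le> 2"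
    unfolding I_def .
qed

text \<open>The set \<open>P\<close> has rank three and exceeds the rank-2 set \<open>I = X \<inter> P\<close> by one element \<open>y\<close>. As the complement of \<open>I\<close>
spans but that of \<open>P\<close> does not, \<open>y\<close> is in the coclosure of \<open>I\<close>. So the case of a line applies to \<open>I\<close>,
or \<open>I\<close> has two elements, and they form a triangle with \<open>f\<close> and a triad with \<open>y\<close>.\<close>

lemma thin_side:
  assumes S: "separation3 E r P f Q" and X: "X \<subseteq> E" "f \<in> X" "4 \<le> card (E - X)"
    and c: "card (P - X) \<le> 1" and fI: "2 \<le> card (X \<inter> P) \<Longrightarrow> f \<in> cl (X \<inter> P)" and rI: "r (insert f (X \<inter> P)) \<le> 2"
  shows "2 \<le> num_unblocked X"
proof -
  have S': "f \<notin> P" "f \<notin> Q" "P \<inter> Q = {}" "3 \<le> r P" "3 \<le> r Q" "r P + r Q = r E + 2" "r (insert f Q) = r Q"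
    using S unfolding separation3_def by blast+
  have sb: "P \<subseteq> E" "Q \<subseteq> E" "f \<in> E" using separation3_sub[OF S] by auto
  define I where "I = X \<inter> P"
  have IE: "I \<subseteq> E" "insert f I \<subseteq> E" "f \<notin> I" using sb S' unfolding I_def by auto
  have finP: "finite P" using sb finite_sub by blast
  have rI2: "r I \<le> 2" using rI r_step[OF IE(1) sb(3)] unfolding I_def by simp
  have "P - X \<noteq> {}"
  proof
    assume "P - X = {}"
    hence "I = P" unfolding I_def by auto
    thus False using rI2 S' by simp
  qed
  then obtain y where y: "P - X = {y}" using c finP
    by (metis One_nat_def card_1_singletonE card_0_eq finite_Diff le_Suc_eq le_zero_eq)
  have PI: "P = insert y I" "y \<notin> I" "y \<in> E" "y \<noteq> f" using y sb X unfolding I_def by auto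
  have "3 \<le> card P" using card_ge_of_r[of P 3] S' sb by auto
  hence cI: "2 \<le> card I" using PI finite_sub[OF IE(1)] by simp
  have "r P \<le> r I + 1" using r_step[OF IE(1) PI(3)] PI(1) by simp
  hence rP: "r P = 3" using S' rI2 by simp
  have EP: "E - insert y I = insert f Q" using separation3_compl[OF S] PI(1) by simp
  have rEP: "r (E - insert y I) = r E - 1" using S' rP EP by simp
  have IX: "I \<subseteq> X" unfolding I_def by auto
  have "card (E - X) \<le> card (E - I)" using IX fin by (intro card_mono) auto
  hence cc: "2 \<le> card (E - I)" using X by simp
  hence "2 \<le> lam I" using conn2[of I] cI IE by simp
  hence "r E \<le> r (E - I)" using lam_eq[OF IE(1)] rI2 by simp
  moreover have "r (E - I) \<le> r E" by (intro r_mono) auto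
  ultimately have sy: "s (insert y I) = s I" using s_insert_iff[of I y] IE PI rEP by simp
  show ?thesis
  proof (cases "3 \<le> card I")
    case True
    have "2 \<le> num_unblocked I" using two_unblocked_on_coclosed_line[OF IE(1) rI2 True _ sy cc] PI by auto
    thus ?thesis using num_unblocked_mono[OF IX X(1)] by simp
  next
    case False
    hence "card I = 2" using cI by simp
    then obtain a b where ab: "I = {a,b}" "a \<noteq> b" by (auto simp: card_2_iff)
    have "card {a,b,y} = 3" using ab PI by auto
    moreover have ie: "insert y {a,b} = {a,b,y}" by auto
    moreover have abE: "{a,b,y} \<subseteq> E" using ab IE PI by auto
    ultimately have "s {a,b,y} = 2" using s_eq[OF abE] rEP ab by simp
    moreover have "r {f,a,b} \<le> 2" using rI ab unfolding I_def by simp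
    moreover have "distinct [f,a,b,y]" using ab PI IE by auto
    ultimately show ?thesis using no_fan[of f a b y] abE sb by auto
  qed
qed

lemma crossing:
  assumes X: "X \<subseteq> E" "lam X = 2" "4 \<le> card (E - X)" "f \<in> X" and S: "separation3 E r P f Q"
    and IH: "\<And>X' f' Y'. X' \<subset> X \<Longrightarrow> separation3 E r X' f' Y' \<Longrightarrow> 2 \<le> num_unblocked X'"
  shows "2 \<le> num_unblocked X \<or> (\<exists>L1 L2. line_pair r X f L1 L2)"
proof (rule disjCI)
  assume no: "\<not> (\<exists>L1 L2. line_pair r X f L1 L2)"
  show "2 \<le> num_unblocked X"
  proof (rule ccontr)
    assume nf: "\<not> 2 \<le> num_unblocked X"
    have nosep: "\<not> separation3 E r (X \<inter> A) f Y" if "f \<notin> A" for A Y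
    proof
      assume "separation3 E r (X \<inter> A) f Y"
      moreover have "X \<inter> A \<subset> X" using that X by auto
      ultimately have "2 \<le> num_unblocked (X \<inter> A)" using IH by blast
      thus False using nf num_unblocked_mono[of "X \<inter> A" X] X by fastforce
    qed
    have fPQ: "f \<notin> P" "f \<notin> Q" "P \<inter> Q = {}" and U: "E \<subseteq> insert f (P \<union> Q)"
      using S unfolding separation3_def by blast+
    have sb: "P \<subseteq> E" "Q \<subseteq> E" using separation3_sub[OF S] by auto
    have half: "r (insert f (X \<inter> A)) \<le> 2" "2 \<le> card (A - X)"
      if T: "separation3 E r A f B" "2 \<le> card (B - X)" "f \<notin> A" for A B
    proof -
      show 1: "r (insert f (X \<inter> A)) \<le> 2"
        using corner(1)[OF T(1) X(1,2,4) T(2)] nosep[OF T(3)] by blast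
      show "2 \<le> card (A - X)"
        using thin_side[OF T(1) X(1,4,3) _ corner(2)[OF T(1) X(1,2,4) T(2)] 1] nf by linarith
    qed
    \<comment> \<open>One side has two elements outside \<open>X\<close>; then \<open>half\<close> gives the other side two as well, and so applies to both.\<close>
    have "E - X = (P - X) \<union> (Q - X)" using U sb X by auto
    hence "4 \<le> card (P - X) + card (Q - X)" using card_Un_le[of "P - X" "Q - X"] X by simp
    hence "2 \<le> card (P - X) \<or> 2 \<le> card (Q - X)" by linarith
    hence "r (insert f (X \<inter> P)) \<le> 2 \<and> r (insert f (X \<inter> Q)) \<le> 2"
      using half[OF S _ fPQ(1)] half[OF separation3_sym[OF S] _ fPQ(2)] by blast
    moreover have "X = insert f (X \<inter> P) \<union> insert f (X \<inter> Q)" using U X by auto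
    ultimately show False using no unfolding line_pair_def by blast
  qed
qed

text \<open>If \<open>L2\<close> has a single element \<open>g\<close> off \<open>L1\<close>, then \<open>X = L1 \<union> {g}\<close>. Adding \<open>g\<close> to \<open>L1\<close> raises the rank while \<open>\<lambda>\<close> is two
for \<open>X\<close> and at least two for \<open>L1\<close>, so \<open>g\<close> is in the coclosure of the line \<open>L1\<close>.\<close>

lemma second_line_long:
  assumes X: "X \<subseteq> E" "lam X = 2" "4 \<le> card (E - X)" "3 \<le> r X" "3 \<le> s X" and nf: "\<not> 2 \<le> num_unblocked X"
    and LP: "line_pair r X f L1 L2"
  shows "3 \<le> card L2"
proof (rule ccontr)
  have L: "X = L1 \<union> L2" "f \<in> L1" "f \<in> L2" "r L1 \<le> 2" "r L2 \<le> 2" using LP unfolding line_pair_def by blast+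
  assume "\<not> 3 \<le> card L2"
  moreover have finL: "finite L1" "finite L2" using X L finite_sub[of X] by auto
  ultimately have "card (L2 - {f}) \<le> Suc 0" using L by simp
  moreover have "\<not> L2 - {f} \<subseteq> L1"
  proof
    assume "L2 - {f} \<subseteq> L1"
    hence "X = L1" using L by auto
    thus False using L X by simp
  qed
  ultimately obtain g where g: "g \<in> L2" "g \<notin> L1" "L2 - {f} \<subseteq> {g}"
    using finL card_le_Suc0_iff_eq[of "L2 - {f}"] by blast
  have Xg: "X = insert g L1" using g L by auto
  have LE: "L1 \<subseteq> E" "g \<in> E" "g \<in> E - L1" using X Xg g by auto
  have rX: "r X = 3" using r_step[OF LE(1,2)] Xg L X by auto
  have cX: "card X = card L1 + 1" using Xg g finL by simp
  have "int (card X) = r X + s X - 2" using X by (simp add: lam_def)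
  hence c3: "3 \<le> card L1" using X rX cX by linarith
  have "card (E - X) \<le> card (E - L1)" using L fin by (intro card_mono) auto
  hence cc: "2 \<le> card (E - L1)" using X by simp
  hence "2 \<le> lam L1" using conn2[of L1] c3 LE by simp
  hence "s L1 \<ge> s X" using X rX L cX by (simp add: lam_def)
  moreover have "s L1 \<le> s X"
  proof -
    interpret D: rank_pair E s r by (rule dual)
    show ?thesis using L X by (intro D.r_mono) auto
  qed
  ultimately have "s (insert g L1) = s L1" using Xg by simp
  hence "2 \<le> num_unblocked L1" using two_unblocked_on_coclosed_line[OF LE(1) L(4) c3 LE(3) _ cc] by blast
  thus False using nf num_unblocked_mono[of L1 X] L X by auto
qed

lemma long_line_pair:
  assumes X: "X \<subseteq> E" "lam X = 2" "4 \<le> card (E - X)" "3 \<le> r X" "3 \<le> s X" and nf: "\<not> 2 \<le> num_unblocked X"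
    and LP: "line_pair r X f L1 L2"
  shows "3 \<le> card L1" "3 \<le> card L2" "r X = 3" "4 \<le> s X"
proof -
  show c1: "3 \<le> card L1" by (rule second_line_long[OF X nf line_pair_sym[OF LP]])
  show c2: "3 \<le> card L2" by (rule second_line_long[OF X nf LP])
  have L: "X = L1 \<union> L2" "f \<in> L1" "f \<in> L2" "r L1 \<le> 2" "r L2 \<le> 2" using LP unfolding line_pair_def by blast+
  have LE: "L1 \<subseteq> E" "L2 \<subseteq> E" "L1 \<inter> L2 \<subseteq> E" using L X by auto
  have sm: "r X + r (L1 \<inter> L2) \<le> 4" using r_submod[OF LE(1,2)] L by simp
  have "r {f} \<le> r (L1 \<inter> L2)" using L LE by (intro r_mono) auto
  moreover have "r {f} = 1" using L X by (intro r_single) auto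
  ultimately show r3: "r X = 3" using sm X by simp
  have "card (L1 \<inter> L2) \<le> 1"
  proof (rule ccontr)
    assume "\<not> card (L1 \<inter> L2) \<le> 1"
    hence "2 \<le> card (L1 \<inter> L2)" by simp
    then obtain x y where "x \<in> L1 \<inter> L2" "y \<in> L1 \<inter> L2" "x \<noteq> y" by (rule two_elems)
    hence "2 \<le> r (L1 \<inter> L2)" by (rule r_ge2[OF LE(3)])
    thus False using sm X by simp
  qed
  hence "5 \<le> card X" using card_Un_Int[of L1 L2] c1 c2 LE L finite_sub by simp
  thus "4 \<le> s X" using X r3 by (simp add: lam_def)
qed

text \<open>An element \<open>g\<close> other than \<open>f\<close>, on the one line say, is off the other line. So each of \<open>K1\<close> and \<open>K2\<close>, being a line
through \<open>g\<close>, contains at most one of the three elements of that other line.\<close>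

lemma unique_line_pair:
  assumes X: "X \<subseteq> E" "3 \<le> r X"
    and LP: "line_pair r X f L1 L2" and c: "3 \<le> card L1" "3 \<le> card L2" and KP: "line_pair r X g K1 K2"
  shows "f = g"
proof (rule ccontr)
  assume ne: "f \<noteq> g"
  have K: "X = K1 \<union> K2" "g \<in> K1" "g \<in> K2" "r K1 \<le> 2" "r K2 \<le> 2" using KP unfolding line_pair_def by blast+
  have *: False if MP: "line_pair r X f M1 M2" and M: "3 \<le> card M2" "g \<in> M1" for M1 M2
  proof -
    have L: "X = M1 \<union> M2" "f \<in> M1" "f \<in> M2" "r M1 \<le> 2" "r M2 \<le> 2" "3 \<le> card M2" "g \<in> M1"
      using MP M unfolding line_pair_def by blast+
    have ME: "M1 \<subseteq> E" "M2 \<subseteq> E" using L X by auto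
    have g: "g \<notin> cl M2"
    proof
      assume "g \<in> cl M2"
      hence "cl {f,g} \<subseteq> cl M2" using L ME cl_ext[of M2] by (intro cl_least) auto
      moreover have "M1 \<subseteq> cl {f,g}" using L ME ne by (intro line_cl) auto
      ultimately have "X \<subseteq> cl M2" using L ME cl_ext[of M2] by auto
      thus False using r_sub_cl[OF ME(2), of X] L X by simp
    qed
    have one: False if "a \<in> M2" "b \<in> M2" "a \<noteq> b" "a \<in> A" "b \<in> A" "g \<in> A" "r A \<le> 2" "A \<subseteq> E" for a b A
    proof -
      have "A \<subseteq> cl {a,b}" using that by (intro line_cl) auto
      moreover have "cl {a,b} \<subseteq> cl M2" using that ME by (intro cl_mono) auto
      ultimately show False using g that by auto
    qed
    have "finite M2" using ME finite_sub by blast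
    hence "2 \<le> card (M2 - {f})" using L by simp
    then obtain u v where uv: "u \<in> M2 - {f}" "v \<in> M2 - {f}" "u \<noteq> v" by (rule two_elems)
    have KE: "K1 \<subseteq> E" "K2 \<subseteq> E" using K X by auto
    have mem: "f \<in> K1 \<or> f \<in> K2" "u \<in> K1 \<or> u \<in> K2" "v \<in> K1 \<or> v \<in> K2" using uv L K by auto
    have "\<not> (f \<in> A \<and> u \<in> A)" "\<not> (f \<in> A \<and> v \<in> A)" "\<not> (u \<in> A \<and> v \<in> A)"
      if "g \<in> A" "r A \<le> 2" "A \<subseteq> E" for A
      using one[of f u A] one[of f v A] one[of u v A] uv L that by auto
    from this[OF K(2,4) KE(1)] this[OF K(3,5) KE(2)] show False using mem by blast
  qed
  have "g \<in> L1 \<or> g \<in> L2" using LP K(1,2) unfolding line_pair_def by blast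
  thus False using *[OF LP c(2)] *[OF line_pair_sym[OF LP] c(1)] by blast
qed

text \<open>A side of rank or corank two is a line or the dual of one, with \<open>e\<close> in its coclosure or closure. Otherwise
all but one element of \<open>X\<close> being blocked would give two line pairs, or two dual line pairs, or one of each
kind. The first two are excluded by uniqueness, and the last by the ranks, as a line pair makes \<open>r(X) = 3\<close> and
\<open>s(X) \<ge> 4\<close>.\<close>

lemma two_unblocked_in_side:
  assumes "separation3 E r X e Y \<or> separation3 E s X e Y"
  shows "2 \<le> num_unblocked X"
  using assms
proof (induction "card X" arbitrary: X e Y rule: less_induct)
  case less
  interpret D: tame_pair E s r by (rule dual_tame)
  have lamD: "D.lam A = lam A" for A by (simp add: lam_def D.lam_def)
  have blD: "D.blocked f = blocked f" for f by (auto simp: blocked_def D.blocked_def)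
  have X: "X \<subseteq> E" using less.prems separation3_sub[of X e Y] D.separation3_sub[of X e Y] by auto
  have lX: "lam X = 2"
    using less.prems separation3_lam(1)[of X e Y] D.separation3_lam(1)[of X e Y, unfolded lamD] by auto
  have Y: "E - X = insert e Y" "e \<notin> Y" "Y \<subseteq> E" using less.prems unfolding separation3_def by auto
  have "3 \<le> card Y" using less.prems card_ge_of_r[of Y 3] D.card_ge_of_r[of Y 3] Y
    unfolding separation3_def by auto
  hence cc: "4 \<le> card (E - X)" using Y finite_sub[of Y] by simp
  have cc2: "2 \<le> card (E - X)" using cc by simp
  have c3: "3 \<le> card X" using less.prems card_ge_of_r[of X 3] D.card_ge_of_r[of X 3] X
    unfolding separation3_def by auto
  have e: "e \<in> E - X" using Y by auto
  show "2 \<le> num_unblocked X"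
  proof (rule ccontr)
    assume nf: "\<not> 2 \<le> num_unblocked X"
    have rX: "3 \<le> r X"
    proof (rule ccontr)
      assume "\<not> 3 \<le> r X"
      hence "r X \<le> 2" "s (insert e X) = s X" using less.prems unfolding separation3_def by auto
      thus False using two_unblocked_on_coclosed_line[OF X _ c3 e _ cc2] nf by blast
    qed
    have sX: "3 \<le> s X"
    proof (rule ccontr)
      assume "\<not> 3 \<le> s X"
      hence "s X \<le> 2" "r (insert e X) = r X" using less.prems unfolding separation3_def by auto
      thus False using D.two_unblocked_on_coclosed_line[OF X _ c3 e _ cc2] nf blD by simp
    qed
    have IH: "2 \<le> num_unblocked X'" if "X' \<subset> X" "separation3 E r X' f' Y' \<or> separation3 E s X' f' Y'" for X' f' Y'
      using less.hyps[of X' f' Y'] that psubset_card_mono[OF finite_sub[OF X]] by blast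
    have lines: "(\<exists>L1 L2. line_pair r X f L1 L2) \<or> (\<exists>L1 L2. line_pair s X f L1 L2)"
      if f: "f \<in> X" "blocked f" for f
    proof -
      obtain P Q where "separation3 E r P f Q \<or> separation3 E s P f Q" using f unfolding blocked_def by blast
      thus ?thesis
      proof
        assume "separation3 E r P f Q"
        from crossing[OF X lX cc f(1) this] IH nf show ?thesis by blast
      next
        assume "separation3 E s P f Q"
        from D.crossing[OF X _ cc f(1) this, unfolded blD lamD] IH nf lX show ?thesis by blast
      qed
    qed
    note long = long_line_pair[OF X lX cc rX sX nf]
    note long_dual = D.long_line_pair[OF X _ cc sX rX, unfolded blD lamD, OF lX nf]
    have cX: "int (card X) = r X + s X - 2" using lX by (simp add: lam_def)
    have "X = {f \<in> X. \<not> blocked f} \<union> {f \<in> X. blocked f}" by auto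
    hence "card X \<le> num_unblocked X + card {f \<in> X. blocked f}" using card_Un_le by metis
    moreover have "4 \<le> card X" using cX rX sX by linarith
    ultimately have "2 \<le> card {f \<in> X. blocked f}" using nf by linarith
    then obtain f g where fg: "f \<in> {f \<in> X. blocked f}" "g \<in> {f \<in> X. blocked f}" "f \<noteq> g" by (rule two_elems)
    have notboth: False if "line_pair r X a L1 L2" "line_pair s X b M1 M2" for a b L1 L2 M1 M2
      using long(3)[OF that(1)] long_dual(4)[OF that(2)] by simp
    have same: "a = b" if "line_pair r X a L1 L2" "line_pair r X b M1 M2" for a b L1 L2 M1 M2
      by (rule unique_line_pair[OF X rX that(1) long(1,2)[OF that(1)] that(2)])
    have same_dual: "a = b" if "line_pair s X a L1 L2" "line_pair s X b M1 M2" for a b L1 L2 M1 M2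
      by (rule D.unique_line_pair[OF X sX that(1) long_dual(1,2)[OF that(1)] that(2)])
    show False using lines[of f] lines[of g] fg notboth same same_dual by blast
  qed
qed

end

section \<open>Matroids as rank functions\<close>

definition rk :: "'a pre_matroid \<Rightarrow> 'a set \<Rightarrow> int" where
  "rk M A = int (matroid_rank M A)"

context matroid begin

lemma indep_finite: "indep M I \<Longrightarrow> finite I"
  using indep_subset_ground finite_ground finite_subset by blast

lemma indep_sets_finite: "finite {I. I \<subseteq> A \<and> indep M I}"
proof -
  have "{I. I \<subseteq> A \<and> indep M I} \<subseteq> Pow (ground M)" using indep_subset_ground by auto
  thus ?thesis using finite_ground finite_subset by blast
qed

lemma card_le_rank: "indep M I \<Longrightarrow> I \<subseteq> A \<Longrightarrow> card I \<le> matroid_rank M A"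
  unfolding matroid_rank_def using indep_sets_finite by (intro Max_ge) auto

lemma rank_witness: "\<exists>I\<subseteq>A. indep M I \<and> card I = matroid_rank M A"
proof -
  have "{} \<in> {I. I \<subseteq> A \<and> indep M I}" using indep_empty by simp
  hence "matroid_rank M A \<in> card ` {I. I \<subseteq> A \<and> indep M I}"
    unfolding matroid_rank_def using indep_sets_finite by (intro Max_in) auto
  thus ?thesis by auto
qed

lemma extend_indep: assumes "indep M I" "I \<subseteq> A"
  shows "\<exists>J. I \<subseteq> J \<and> J \<subseteq> A \<and> indep M J \<and> card J = matroid_rank M A"
  using assms
proof (induction "matroid_rank M A - card I" arbitrary: I)
  case 0
  thus ?case using card_le_rank[of I A] by (intro exI[of _ I]) auto
next
  case (Suc n)
  obtain J where J: "J \<subseteq> A" "indep M J" "card J = matroid_rank M A" using rank_witness by blast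
  hence "card I < card J" using Suc.hyps(2) by simp
  then obtain x where x: "x \<in> J - I" "indep M (insert x I)" using augmentation[OF Suc.prems(1) J(2)] by blast
  have "card (insert x I) = Suc (card I)" using x indep_finite[OF Suc.prems(1)] by simp
  moreover have "insert x I \<subseteq> A" using x J Suc.prems by auto
  moreover have "n = matroid_rank M A - card (insert x I)" using calculation Suc.hyps(2) by simp
  ultimately have "\<exists>K. insert x I \<subseteq> K \<and> K \<subseteq> A \<and> indep M K \<and> card K = matroid_rank M A"
    using Suc.hyps(1) x(2) by blast
  thus ?case by auto
qed

lemma indep_iff_rank: assumes "I \<subseteq> ground M" shows "indep M I \<longleftrightarrow> rk M I = int (card I)"
proof
  assume "indep M I"
  moreover have "matroid_rank M I \<le> card I"
    using rank_witness[of I] card_mono[of I] assms finite_ground finite_subset by metis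
  ultimately show "rk M I = int (card I)" using card_le_rank[of I I] unfolding rk_def by simp
next
  assume "rk M I = int (card I)"
  then obtain J where "J \<subseteq> I" "indep M J" "card J = card I" using rank_witness[of I] unfolding rk_def by auto
  moreover have "finite I" using assms finite_ground finite_subset by blast
  ultimately show "indep M I" using card_subset_eq by metis
qed

text \<open>Submodularity: a basis of \<open>A \<inter> B\<close> extends to a basis \<open>K\<close> of \<open>A \<union> B\<close>, and the traces of \<open>K\<close> on \<open>A\<close> and \<open>B\<close> are independent.\<close>

lemma rank_pair_corank:
  "rank_pair (ground M) (rk M) (\<lambda>A. int (card A) + rk M (ground M - A) - rk M (ground M))"
proof
  show "finite (ground M)" by (rule finite_ground)
  show "rk M {} = 0" using rank_witness[of "{}"] unfolding rk_def by auto
  show "rk M A \<le> rk M (insert x A) \<and> rk M (insert x A) \<le> rk M A + 1"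
    if "A \<subseteq> ground M" "x \<in> ground M" for A x
  proof
    obtain I where I: "I \<subseteq> A" "indep M I" "card I = matroid_rank M A" using rank_witness by blast
    thus "rk M A \<le> rk M (insert x A)" using card_le_rank[of I "insert x A"] unfolding rk_def by auto
    obtain J where J: "J \<subseteq> insert x A" "indep M J" "card J = matroid_rank M (insert x A)" using rank_witness by blast
    have "card (J - {x}) \<le> matroid_rank M A" using J by (intro card_le_rank indep_subset[OF J(2)]) auto
    moreover have "card J \<le> card (J - {x}) + 1" using card_Diff1_le[of J x] card_Suc_Diff1[OF indep_finite[OF J(2)], of x] by (cases "x \<in> J") auto
    ultimately show "rk M (insert x A) \<le> rk M A + 1" using J unfolding rk_def by simp
  qed
  show "rk M (A \<union> B) + rk M (A \<inter> B) \<le> rk M A + rk M B" if "A \<subseteq> ground M" "B \<subseteq> ground M" for A B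
  proof -
    obtain I where I: "I \<subseteq> A \<inter> B" "indep M I" "card I = matroid_rank M (A \<inter> B)" using rank_witness by blast
    then obtain K where K: "I \<subseteq> K" "K \<subseteq> A \<union> B" "indep M K" "card K = matroid_rank M (A \<union> B)"
      using extend_indep[of I "A \<union> B"] by blast
    have fK: "finite K" using indep_finite K by blast
    have "card (K \<inter> A) \<le> matroid_rank M A" "card (K \<inter> B) \<le> matroid_rank M B"
      using indep_subset[OF K(3)] by (auto intro!: card_le_rank)
    moreover have "card (K \<inter> A) + card (K \<inter> B) = card K + card (K \<inter> A \<inter> B)"
    proof -
      have "(K \<inter> A) \<union> (K \<inter> B) = K" "(K \<inter> A) \<inter> (K \<inter> B) = K \<inter> A \<inter> B" using K by auto
      thus ?thesis using card_Un_Int[of "K \<inter> A" "K \<inter> B"] fK by simp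
    qed
    moreover have "card I \<le> card (K \<inter> A \<inter> B)" using I K fK by (intro card_mono) auto
    ultimately show ?thesis using I K unfolding rk_def by simp
  qed
qed simp

lemma basis_iff: "basis M B \<longleftrightarrow> indep M B \<and> rk M B = rk M (ground M)"
proof
  assume B: "basis M B"
  hence iB: "indep M B" unfolding basis_def by simp
  then obtain J where "B \<subseteq> J" "indep M J" "card J = matroid_rank M (ground M)"
    using extend_indep[OF iB indep_subset_ground[OF iB]] by blast
  hence "card B = matroid_rank M (ground M)" using B unfolding basis_def by auto
  thus "indep M B \<and> rk M B = rk M (ground M)"
    using iB indep_iff_rank[OF indep_subset_ground[OF iB]] unfolding rk_def by auto
next
  assume a: "indep M B \<and> rk M B = rk M (ground M)"
  show "basis M B" unfolding basis_def
  proof (intro conjI allI impI)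
    fix I assume I: "indep M I" "B \<subseteq> I"
    have "card I \<le> matroid_rank M (ground M)" using I indep_subset_ground by (intro card_le_rank) auto
    also have "\<dots> = card B" using a indep_iff_rank[OF indep_subset_ground] unfolding rk_def by auto
    finally show "I = B" using I indep_finite card_seteq[of I B] by blast
  qed (use a in auto)
qed

end

text \<open>Applied to the corank function, this shows that the dual is a matroid and identifies its rank function.\<close>

lemma matroid_of_rank_pair:
  assumes "rank_pair E r s"
  defines "N \<equiv> \<lparr>ground = E, indep = (\<lambda>I. I \<subseteq> E \<and> r I = int (card I))\<rparr>"
  shows "matroid N" and "\<And>A. A \<subseteq> E \<Longrightarrow> rk N A = r A"
proof -
  interpret rank_pair E r s by fact
  show m: "matroid N"
  proof
    show "indep N J" if "indep N I" "J \<subseteq> I" for I J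
    proof -
      have IE: "I \<subseteq> E" "r I = int (card I)" "finite I" using that finite_sub unfolding N_def by auto
      have "r (J \<union> (I - J)) \<le> r J + int (card (I - J))" using IE that by (intro r_le_union_card) auto
      moreover have "J \<union> (I - J) = I" using that by auto
      moreover have "card (I - J) = card I - card J" "card J \<le> card I"
        using IE that by (auto intro: card_Diff_subset finite_subset card_mono)
      ultimately have "int (card J) \<le> r J" using IE by simp
      thus ?thesis using r_le_card[of J] IE that unfolding N_def by auto
    qed
    show "\<exists>x\<in>J - I. indep N (insert x I)" if "indep N I" "indep N J" "card I < card J" for I J
    proof (rule ccontr)
      assume n: "\<not> (\<exists>x\<in>J - I. indep N (insert x I))"
      have I: "I \<subseteq> E" "J \<subseteq> E" "r I = int (card I)" "r J = int (card J)" "finite I"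
        using that finite_sub unfolding N_def by auto
      have "J \<subseteq> cl I"
      proof
        fix x assume x: "x \<in> J"
        show "x \<in> cl I"
        proof (cases "x \<in> I")
          case False
          show ?thesis
          proof (rule ccontr)
            assume "x \<notin> cl I"
            hence "r (insert x I) = r I + 1" using I x by (intro r_insert_notin_cl) auto
            hence "indep N (insert x I)" using I x False unfolding N_def by auto
            thus False using n x False by blast
          qed
        qed (use cl_ext[OF I(1)] in auto)
      qed
      hence "r J \<le> r I" using r_sub_cl I by blast
      thus False using that I by simp
    qed
  qed (use fin r_empty in \<open>auto simp: N_def\<close>)
  interpret N: matroid N by fact
  show "rk N A = r A" if A: "A \<subseteq> E" for A
  proof -
    obtain I where I: "I \<subseteq> A" "r I = int (card I)" "r I = r A" using rank_attained[OF A] by blast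
    hence "indep N I" using A unfolding N_def by auto
    hence "r A \<le> rk N A" using N.card_le_rank[of I A] I unfolding rk_def by simp
    moreover obtain J where J: "J \<subseteq> A" "indep N J" "card J = matroid_rank N A" using N.rank_witness by blast
    hence "rk N A = r J" unfolding rk_def N_def by auto
    moreover have "r J \<le> r A" using J A by (intro r_mono) auto
    ultimately show ?thesis by simp
  qed
qed

context matroid begin

lemma as_rank_matroid: "M = \<lparr>ground = ground M, indep = (\<lambda>I. I \<subseteq> ground M \<and> rk M I = int (card I))\<rparr>"
  using indep_iff_rank indep_subset_ground by (intro pre_matroid.equality) (auto intro!: ext)

lemma dual_as_rank_matroid:
  "matroid_dual M = \<lparr>ground = ground M, indep = (\<lambda>I. I \<subseteq> ground M \<and>
     int (card I) + rk M (ground M - I) - rk M (ground M) = int (card I))\<rparr>"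
proof -
  interpret P: rank_pair "ground M" "rk M" "\<lambda>A. int (card A) + rk M (ground M - A) - rk M (ground M)"
    by (rule rank_pair_corank)
  have "(\<exists>B. basis M B \<and> I \<subseteq> ground M - B) \<longleftrightarrow> I \<subseteq> ground M \<and> rk M (ground M - I) = rk M (ground M)" for I
  proof
    assume "\<exists>B. basis M B \<and> I \<subseteq> ground M - B"
    then obtain B where B: "basis M B" "I \<subseteq> ground M - B" by blast
    hence "B \<subseteq> ground M - I" using basis_iff indep_subset_ground by blast
    hence "rk M B \<le> rk M (ground M - I)" by (intro P.r_mono) auto
    moreover have "rk M (ground M - I) \<le> rk M (ground M)" by (intro P.r_mono) auto
    ultimately show "I \<subseteq> ground M \<and> rk M (ground M - I) = rk M (ground M)" using B basis_iff by auto
  next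
    assume a: "I \<subseteq> ground M \<and> rk M (ground M - I) = rk M (ground M)"
    obtain B where B: "B \<subseteq> ground M - I" "indep M B" "card B = matroid_rank M (ground M - I)" using rank_witness by blast
    hence "rk M B = rk M (ground M)" using a indep_iff_rank[of B] unfolding rk_def by auto
    hence "basis M B" using basis_iff B by simp
    thus "\<exists>B. basis M B \<and> I \<subseteq> ground M - B" using B a by blast
  qed
  thus ?thesis unfolding matroid_dual_def by simp
qed

lemma ground_dual [simp]: "ground (matroid_dual M) = ground M"
  by (simp add: matroid_dual_def)

lemma matroid_dual: "matroid (matroid_dual M)"
  using matroid_of_rank_pair(1)[OF rank_pair.dual[OF rank_pair_corank]] dual_as_rank_matroid by simp

lemma rk_dual: "A \<subseteq> ground M \<Longrightarrow>
    rk (matroid_dual M) A = int (card A) + rk M (ground M - A) - rk M (ground M)"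
  using matroid_of_rank_pair(2)[OF rank_pair.dual[OF rank_pair_corank]] dual_as_rank_matroid by simp

lemma rank_pair_dual: "rank_pair (ground M) (rk M) (rk (matroid_dual M))"
proof -
  interpret P: rank_pair "ground M" "rk M" "\<lambda>A. int (card A) + rk M (ground M - A) - rk M (ground M)"
    by (rule rank_pair_corank)
  show ?thesis using P.fin P.r_empty P.r_step P.r_submod rk_dual by unfold_locales auto
qed

lemma dual_dual: "matroid_dual (matroid_dual M) = M"
proof -
  interpret D: matroid "matroid_dual M" by (rule matroid_dual)
  interpret P: rank_pair "ground M" "rk (matroid_dual M)" "rk M"
    by (rule rank_pair.dual[OF rank_pair_dual])
  have "I \<subseteq> ground M \<Longrightarrow> int (card I) + rk (matroid_dual M) (ground M - I) - rk (matroid_dual M) (ground M) = rk M I" for I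
    using P.s_eq by simp
  thus ?thesis using D.dual_as_rank_matroid as_rank_matroid by (auto cong: conj_cong)
qed

lemma matroid_restrict: "matroid (matroid_restrict M X)"
proof
  show "\<exists>x\<in>J - I. indep (matroid_restrict M X) (insert x I)"
    if "indep (matroid_restrict M X) I" "indep (matroid_restrict M X) J" "card I < card J" for I J
  proof -
    have IJ: "indep M I" "indep M J" "I \<subseteq> X" "J \<subseteq> X" using that unfolding matroid_restrict_def by auto
    obtain x where "x \<in> J - I" "indep M (insert x I)" using augmentation[OF IJ(1,2)] \<open>card I < card J\<close> by blast
    thus ?thesis using IJ unfolding matroid_restrict_def by auto
  qed
qed (use finite_ground indep_empty in \<open>auto simp: matroid_restrict_def dest: indep_subset_ground indep_subset\<close>)

lemma rk_restrict: assumes "A \<subseteq> X" shows "rk (matroid_restrict M X) A = rk M A"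
proof -
  have "{I. I \<subseteq> A \<and> indep (matroid_restrict M X) I} = {I. I \<subseteq> A \<and> indep M I}"
    using assms unfolding matroid_restrict_def by auto
  thus ?thesis unfolding rk_def matroid_rank_def by simp
qed

lemma ground_restrict [simp]: "ground (matroid_restrict M X) = ground M \<inter> X"
  by (simp add: matroid_restrict_def)

end

lemma (in matroid) contract_single:
  assumes e: "e \<in> ground M"
  shows "matroid (matroid_contract M {e})" "ground (matroid_contract M {e}) = ground M - {e}"
    and "A \<subseteq> ground M - {e} \<Longrightarrow> rk (matroid_contract M {e}) A = rk M (insert e A) - rk M {e}"
proof -
  interpret D: matroid "matroid_dual M" by (rule matroid_dual)
  define N where "N = matroid_delete (matroid_dual M) {e}"
  have N: "N = matroid_restrict (matroid_dual M) (ground M - {e})" unfolding N_def matroid_delete_def by simp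
  interpret N: matroid N unfolding N by (rule D.matroid_restrict)
  have c: "matroid_contract M {e} = matroid_dual N" unfolding matroid_contract_def N_def by simp
  have gN: "ground N = ground M - {e}" unfolding N using e by auto
  show "matroid (matroid_contract M {e})" "ground (matroid_contract M {e}) = ground M - {e}"
    using N.matroid_dual gN c by auto
  assume A: "A \<subseteq> ground M - {e}"
  interpret P: rank_pair "ground M" "rk M" "rk (matroid_dual M)" by (rule rank_pair_dual)
  have 1: "rk N B = int (card B) + rk M (ground M - B) - rk M (ground M)" if "B \<subseteq> ground M - {e}" for B
    using D.rk_restrict[OF that] rk_dual[of B] that unfolding N by auto
  have AE: "insert e A \<subseteq> ground M" "e \<notin> A" using A e by auto
  have "rk (matroid_dual N) A = int (card A) + rk N (ground N - A) - rk N (ground N)"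
    using N.rk_dual[of A] A gN by simp
  moreover have "ground N - A = ground M - insert e A" "ground M - (ground M - insert e A) = insert e A"
    "ground M - (ground M - {e}) = {e}" using gN AE by auto
  moreover have "int (card (ground M - insert e A)) = int (card (ground M)) - int (card A) - 1"
    using P.card_compl[OF AE(1)] AE P.finite_sub[OF AE(1)] by simp
  moreover have "int (card (ground M - {e})) = int (card (ground M)) - 1"
    using P.card_compl[of "{e}"] e by simp
  ultimately show "rk (matroid_contract M {e}) A = rk M (insert e A) - rk M {e}"
    unfolding c using 1[of "ground M - insert e A"] 1[of "ground M - {e}"] gN A
    by (simp add: Diff_mono)
qed

section \<open>Nonelastic elements give 3-separations\<close>

lemma three_connectedD:
  assumes "n_connected 3 M" and A: "A \<subseteq> ground M"
  shows "A \<noteq> {} \<Longrightarrow> A \<noteq> ground M \<Longrightarrow> finite (ground M) \<Longrightarrow> rk M A + rk M (ground M - A) \<ge> rk M (ground M) + 1"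
    and "2 \<le> card A \<Longrightarrow> 2 \<le> card (ground M - A) \<Longrightarrow> rk M A + rk M (ground M - A) \<ge> rk M (ground M) + 2"
proof -
  have c: "connectivity M A = rk M A + rk M (ground M - A) - rk M (ground M)"
    by (simp add: connectivity_def rk_def)
  have "\<not> k_separation M 1 A" "\<not> k_separation M 2 A" using assms unfolding n_connected_def by auto
  note n = this[unfolded k_separation_def c]
  show "rk M A + rk M (ground M - A) \<ge> rk M (ground M) + 2" if "2 \<le> card A" "2 \<le> card (ground M - A)"
    using n(2) A that by simp
  show "rk M A + rk M (ground M - A) \<ge> rk M (ground M) + 1"
    if a: "A \<noteq> {}" "A \<noteq> ground M" "finite (ground M)"
  proof -
    have "finite A" "ground M - A \<noteq> {}" using A a finite_subset by auto
    hence "1 \<le> card A" "1 \<le> card (ground M - A)" using a by (auto simp: Suc_le_eq card_gt_0_iff)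
    thus ?thesis using n(1) A by simp
  qed
qed

context matroid begin

lemma n_connected_dual: "n_connected n (matroid_dual M) = n_connected n M"
proof -
  have "k_separation (matroid_dual M) k X = k_separation M k X" for k X
  proof (cases "X \<subseteq> ground M")
    case True
    interpret P: rank_pair "ground M" "rk M" "rk (matroid_dual M)" by (rule rank_pair_dual)
    interpret D: rank_pair "ground M" "rk (matroid_dual M)" "rk M" by (rule P.dual)
    have "connectivity (matroid_dual M) X = D.lam X" using D.lam_eq[OF True] by (simp add: connectivity_def rk_def)
    moreover have "connectivity M X = P.lam X" using P.lam_eq[OF True] by (simp add: connectivity_def rk_def)
    moreover have "D.lam X = P.lam X" by (simp add: D.lam_def P.lam_def)
    ultimately show ?thesis by (simp add: k_separation_def)
  qed (auto simp: k_separation_def)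
  thus ?thesis by (simp add: n_connected_def)
qed

text \<open>Deletability in \<open>M\<close> is contractibility in the dual, because 3-connectivity is self-dual.\<close>

lemma cosimplification_delete_connected_iff:
  assumes "e \<in> ground M"
  shows "n_connected 3 (cosimplification (matroid_delete M {e})) =
    n_connected 3 (simplification (matroid_contract (matroid_dual M) {e}))"
proof -
  interpret D: matroid "matroid_dual M" by (rule matroid_dual)
  define N where "N = matroid_contract (matroid_dual M) {e}"
  have "N = matroid_dual (matroid_delete M {e})" unfolding N_def matroid_contract_def by (simp add: dual_dual)
  hence "cosimplification (matroid_delete M {e}) = matroid_dual (simplification N)" by (simp add: cosimplification_def)
  moreover interpret N: matroid N unfolding N_def using D.contract_single(1) assms by simp
  interpret S: matroid "simplification N" unfolding simplification_def by (rule N.matroid_restrict)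
  show ?thesis using calculation S.n_connected_dual unfolding N_def by simp
qed

lemma is_loop_iff: "is_loop M x \<longleftrightarrow> x \<in> ground M \<and> rk M {x} = 0"
proof (cases "x \<in> ground M")
  case True
  interpret P: rank_pair "ground M" "rk M" "rk (matroid_dual M)" by (rule rank_pair_dual)
  have "is_loop M x \<longleftrightarrow> \<not> indep M {x}" using True indep_empty
    unfolding is_loop_def circuit_def by (auto simp: psubset_eq subset_singleton_iff)
  thus ?thesis using True indep_iff_rank[of "{x}"] P.r_nonneg[of "{x}"] P.r_le_card[of "{x}"] by auto
qed (auto simp: is_loop_def circuit_def)

text \<open>Phrased with ranks, being parallel is visibly an equivalence relation on the nonloops.\<close>

lemma parallel_class_eq:
  assumes "x \<in> ground M" "rk M {x} = 1"
  shows "parallel_class M x = {y \<in> ground M. rk M {y} = 1 \<and> rk M {x,y} = 1}"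
proof -
  interpret P: rank_pair "ground M" "rk M" "rk (matroid_dual M)" by (rule rank_pair_dual)
  have nl: "\<not> is_loop M y \<longleftrightarrow> rk M {y} = 1" if "y \<in> ground M" for y
  proof -
    have "0 \<le> rk M {y}" "rk M {y} \<le> 1" using that P.r_nonneg[of "{y}"] P.r_le_card[of "{y}"] by simp_all
    thus ?thesis using that is_loop_iff[of y] by auto
  qed
  have "circuit M {x,y} \<longleftrightarrow> rk M {x,y} = 1" if y: "y \<in> ground M" "rk M {y} = 1" "y \<noteq> x" for y
  proof -
    have i: "indep M {}" "indep M {x}" "indep M {y}" using indep_empty assms y indep_iff_rank by auto
    have "I = {} \<or> I = {x} \<or> I = {y}" if "I \<subset> {x,y}" for I using that y(3) by blast
    hence "circuit M {x,y} \<longleftrightarrow> \<not> indep M {x,y}" using i assms(1) y(1) unfolding circuit_def by blast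
    moreover have "rk M {x,y} \<le> 2" "1 \<le> rk M {x,y}"
      using P.r_le_card[of "{x,y}"] P.r_mono[of "{x}" "{x,y}"] assms y by auto
    ultimately show ?thesis using indep_iff_rank[of "{x,y}"] assms y by auto
  qed
  hence "y \<in> parallel_class M x \<longleftrightarrow> y \<in> ground M \<and> rk M {y} = 1 \<and> rk M {x,y} = 1" for y
    using nl[of y] assms unfolding parallel_class_def by (cases "y = x") auto
  thus ?thesis by blast
qed

text \<open>Sort the elements by their representatives, with the loops on the first side. Neither side gains rank over its
set of representatives, and two distinct representatives have rank two. For a 0-separation there is
nothing to transport, since \<open>\<lambda>\<close> is never negative.\<close>

lemma simplification_separation:
  assumes "\<not> n_connected 3 (simplification M)"
  obtains P Q where "P \<union> Q = ground M" "P \<inter> Q = {}"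
    "1 \<le> rk M P \<and> 1 \<le> rk M Q \<and> rk M P + rk M Q \<le> rk M (ground M) \<or>
     2 \<le> rk M P \<and> 2 \<le> rk M Q \<and> rk M P + rk M Q \<le> rk M (ground M) + 1"
proof -
  interpret P: rank_pair "ground M" "rk M" "rk (matroid_dual M)" by (rule rank_pair_dual)
  let ?E = "ground M"
  define rep where "rep x = (SOME f. f \<in> parallel_class M x)" for x
  define A where "A = {x \<in> ?E. rk M {x} = 1}"
  define S where "S = rep ` A"
  have zero: "rk M {x} = 0" if "x \<in> ?E" "x \<notin> A" for x
    using that P.r_nonneg[of "{x}"] P.r_le_card[of "{x}"] unfolding A_def by auto
  have pclass: "parallel_class M x = {y \<in> A. y \<in> P.cl {x}}" if "x \<in> A" for x
    using parallel_class_eq[of x] that unfolding A_def P.cl_def by (auto simp: insert_commute)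
  have rep: "rep x \<in> A" "rep x \<in> P.cl {x}" if "x \<in> A" for x
  proof -
    have "x \<in> parallel_class M x" using pclass[OF that] that P.cl_ext[of "{x}"] unfolding A_def by auto
    hence "rep x \<in> parallel_class M x" unfolding rep_def by (rule someI)
    thus "rep x \<in> A" "rep x \<in> P.cl {x}" using pclass[OF that] by auto
  qed
  have clsym: "x \<in> P.cl {y}" if "x \<in> A" "y \<in> A" "y \<in> P.cl {x}" for x y
    using that unfolding A_def P.cl_def by (auto simp: insert_commute)
  have cleq: "P.cl {x} = P.cl {y}" if "x \<in> A" "y \<in> A" "y \<in> P.cl {x}" for x y
    using P.cl_least[of "{x}" "{y}"] P.cl_least[of "{y}" "{x}"] clsym[OF that] that unfolding A_def by auto
  have repeq: "rep x = rep y" if "x \<in> A" "y \<in> A" "y \<in> P.cl {x}" for x y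
    using pclass[OF that(1)] pclass[OF that(2)] cleq[OF that] unfolding rep_def by simp
  have repS: "rep s = s" if "s \<in> S" for s
  proof -
    obtain x where x: "x \<in> A" "s = rep x" using \<open>s \<in> S\<close> unfolding S_def by blast
    thus ?thesis using repeq[of x s] rep[of x] by simp
  qed
  have SE: "S \<subseteq> ?E" "S \<subseteq> A" using rep unfolding S_def A_def by auto
  have si: "simplification M = matroid_restrict M S"
  proof -
    have "{e \<in> ?E. \<not> is_loop M e} = A" using is_loop_iff zero unfolding A_def by auto
    thus ?thesis unfolding simplification_def S_def rep_def by simp
  qed
  have gS: "ground (simplification M) = S" using SE unfolding si by auto
  obtain k X where k: "k < 3" "k_separation (simplification M) k X" using assms unfolding n_connected_def by auto
  have XS: "X \<subseteq> S" and cX: "k \<le> card X" "k \<le> card (S - X)"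
    and con: "connectivity (simplification M) X \<le> int k - 1"
    using k gS unfolding k_separation_def by auto
  have "connectivity (simplification M) X = rk M X + rk M (S - X) - rk M S"
    using XS rk_restrict[of _ S] gS unfolding connectivity_def rk_def si by auto
  hence le: "rk M X + rk M (S - X) \<le> rk M S + int k - 1" using con by simp
  define P where "P = {x \<in> ?E. x \<notin> A \<or> rep x \<in> X}"
  define Q where "Q = {x \<in> A. rep x \<in> S - X}"
  have PQ: "P \<union> Q = ?E" "P \<inter> Q = {}" unfolding P_def Q_def S_def A_def by auto
  have incl: "x \<in> P.cl Y" if "x \<in> A" "rep x \<in> Y" "Y \<subseteq> S" for x Y
    using clsym[of x "rep x"] rep[OF that(1)] that P.cl_mono[of "{rep x}" Y] SE by auto
  have "P \<subseteq> P.cl X"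
  proof
    fix x assume x: "x \<in> P"
    show "x \<in> P.cl X"
    proof (cases "x \<in> A")
      case True
      thus ?thesis using x incl XS unfolding P_def by auto
    next
      case False
      hence "x \<in> P.cl {}" using zero x P.r_empty unfolding P_def P.cl_def by auto
      thus ?thesis using P.cl_mono[of "{}" X] XS SE by auto
    qed
  qed
  hence rP: "rk M P \<le> rk M X" using XS SE by (intro P.r_sub_cl) auto
  have "Q \<subseteq> P.cl (S - X)" using incl unfolding Q_def by auto
  hence rQ: "rk M Q \<le> rk M (S - X)" using SE by (intro P.r_sub_cl) auto
  have "rk M S \<le> rk M ?E" using SE by (intro P.r_mono) auto
  hence sum: "rk M P + rk M Q \<le> rk M ?E + int k - 1" using le rP rQ by simp
  have XP: "X \<subseteq> P" "S - X \<subseteq> Q" using repS XS SE unfolding P_def Q_def by auto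
  have PE: "P \<subseteq> ?E" "Q \<subseteq> ?E" using PQ by auto
  \<comment> \<open>Representatives are pairwise nonparallel nonloops, so their number bounds small ranks from below.\<close>
  have low1: "1 \<le> rk M Z" if "Y \<subseteq> S" "1 \<le> card Y" "Y \<subseteq> Z" "Z \<subseteq> ?E" for Y Z
  proof -
    have "Y \<noteq> {}" using that by auto
    then obtain y where "y \<in> Y" by blast
    hence "rk M {y} = 1" "{y} \<subseteq> Z" using that SE unfolding A_def by auto
    thus ?thesis using P.r_mono[of "{y}" Z] that by simp
  qed
  have low2: "2 \<le> rk M Z" if "Y \<subseteq> S" "2 \<le> card Y" "Y \<subseteq> Z" "Z \<subseteq> ?E" for Y Z
  proof -
    have "\<not> (\<forall>x\<in>Y. \<forall>y\<in>Y. x = y)" using that card_le_Suc0_iff_eq[of Y] card.infinite by fastforce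
    then obtain x y where xy: "x \<in> Y" "y \<in> Y" "x \<noteq> y" by blast
    hence "x \<in> A" "y \<in> A" using that SE by auto
    moreover have "rep x \<noteq> rep y" using repS xy that(1) by (metis subsetD)
    hence "y \<notin> P.cl {x}" using repeq[of x y] calculation by blast
    ultimately have "rk M (insert y {x}) = rk M {x} + 1" unfolding A_def by (intro P.r_insert_notin_cl) auto
    moreover have "rk M (insert y {x}) \<le> rk M Z" using xy that by (intro P.r_mono) auto
    ultimately show ?thesis using \<open>x \<in> A\<close> unfolding A_def by auto
  qed
  consider "k = 0" | "k = 1" | "k = 2" using k by linarith
  hence "1 \<le> rk M P \<and> 1 \<le> rk M Q \<and> rk M P + rk M Q \<le> rk M ?E \<or>
     2 \<le> rk M P \<and> 2 \<le> rk M Q \<and> rk M P + rk M Q \<le> rk M ?E + 1"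
  proof cases
    case 1
    have "rk M (X \<union> (S - X)) + rk M (X \<inter> (S - X)) \<le> rk M X + rk M (S - X)"
      using XS SE by (intro P.r_submod) auto
    moreover have "X \<union> (S - X) = S" "X \<inter> (S - X) = {}" using XS by auto
    ultimately show ?thesis using le 1 P.r_empty by simp
  next
    case 2
    thus ?thesis using low1[of X P] low1[of "S - X" Q] cX XS XP PE sum by simp
  next
    case 3
    thus ?thesis using low2[of X P] low2[of "S - X" Q] cX XS XP PE sum by simp
  qed
  thus ?thesis using that PQ by blast
qed

text \<open>In terms of \<open>M\<close> the two sides together with \<open>e\<close> satisfy \<open>r(P \<union> {e}) + r(Q \<union> {e}) \<le> r(E) + 2\<close>, while 3-connectivity
gives \<open>r(P) + r(Q \<union> {e}) \<ge> r(E) + 2\<close> and the same with \<open>P\<close> and \<open>Q\<close> exchanged. Hence \<open>e\<close> is spanned by both sides.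
A 1-separation of the simplification is excluded by the same inequalities.\<close>

lemma separation3_of_not_contractible:
  assumes conn: "n_connected 3 M" and e: "e \<in> ground M" and nc: "\<not> contractible M e"
  shows "\<exists>P Q. separation3 (ground M) (rk M) P e Q"
proof -
  interpret P: rank_pair "ground M" "rk M" "rk (matroid_dual M)" by (rule rank_pair_dual)
  let ?E = "ground M"
  define N where "N = matroid_contract M {e}"
  interpret N: matroid N unfolding N_def by (rule contract_single(1)[OF e])
  have gN: "ground N = ?E - {e}" unfolding N_def by (rule contract_single(2)[OF e])
  have rN: "rk N A = rk M (insert e A) - rk M {e}" if "A \<subseteq> ?E - {e}" for A
    unfolding N_def by (rule contract_single(3)[OF e that])
  have "\<not> n_connected 3 (simplification N)" using nc e unfolding contractible_def N_def by simp
  then obtain P Q where PQ: "P \<union> Q = ?E - {e}" "P \<inter> Q = {}"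
    and rPQ: "1 \<le> rk N P \<and> 1 \<le> rk N Q \<and> rk N P + rk N Q \<le> rk N (?E - {e}) \<or>
     2 \<le> rk N P \<and> 2 \<le> rk N Q \<and> rk N P + rk N Q \<le> rk N (?E - {e}) + 1"
    using N.simplification_separation gN by metis
  have sb: "P \<subseteq> ?E" "Q \<subseteq> ?E" "P \<subseteq> ?E - {e}" "Q \<subseteq> ?E - {e}" "e \<notin> P" "e \<notin> Q" using PQ by auto
  have cm: "?E - P = insert e Q" "?E - Q = insert e P" "?E - {e} = P \<union> Q" "insert e (?E - {e}) = ?E" using PQ e by auto
  have "rk N {} = 0" by (rule rank_pair.r_empty[OF N.rank_pair_dual])
  hence ne: "P \<noteq> {}" "Q \<noteq> {}" using rPQ by auto
  have "rk M {e} + rk M (?E - {e}) \<ge> rk M ?E + 1"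
    using e ne cm finite_ground by (intro three_connectedD(1)[OF conn]) auto
  moreover have "rk M (?E - {e}) \<le> rk M ?E" by (intro P.r_mono) auto
  moreover have "rk M {e} \<le> 1" using P.r_le_card[of "{e}"] e by simp
  ultimately have re: "rk M {e} = 1" by simp
  have R: "rk N P = rk M (insert e P) - 1" "rk N Q = rk M (insert e Q) - 1" "rk N (?E - {e}) = rk M ?E - 1"
    using rN sb re cm by auto
  have stp: "rk M (insert e P) \<le> rk M P + 1" "rk M (insert e Q) \<le> rk M Q + 1"
    "rk M P \<le> rk M (insert e P)" "rk M Q \<le> rk M (insert e Q)"
    using P.r_step e sb by auto
  have c1: "rk M P + rk M (insert e Q) \<ge> rk M ?E + 1" "rk M Q + rk M (insert e P) \<ge> rk M ?E + 1"
    using three_connectedD(1)[OF conn, of P] three_connectedD(1)[OF conn, of Q] ne sb e finite_ground cm by auto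
  have "2 \<le> rk M P" "2 \<le> rk M Q" using rPQ R c1 stp by linarith+
  hence cd: "2 \<le> card P" "2 \<le> card Q" using P.r_le_card[of P] P.r_le_card[of Q] sb by auto
  have "card P \<le> card (insert e P)" "card Q \<le> card (insert e Q)"
    using P.finite_sub sb by (auto intro!: card_mono)
  hence c2: "rk M P + rk M (insert e Q) \<ge> rk M ?E + 2" "rk M Q + rk M (insert e P) \<ge> rk M ?E + 2"
    using three_connectedD(2)[OF conn, of P] three_connectedD(2)[OF conn, of Q] cd sb cm by auto
  have "rk M (insert e P) = rk M P" "rk M (insert e Q) = rk M Q" "rk M P + rk M Q = rk M ?E + 2"
    "3 \<le> rk M P" "3 \<le> rk M Q"
    using rPQ R c2 stp by linarith+
  moreover have "?E = insert e (P \<union> Q)" using PQ e by auto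
  ultimately have "separation3 ?E (rk M) P e Q" using PQ(2) sb(5,6) unfolding separation3_def by blast
  thus ?thesis by blast
qed

lemma separation3_of_not_elastic:
  assumes conn: "n_connected 3 M" and e: "e \<in> ground M" and ne: "\<not> elastic M e"
  shows "\<exists>P Q. separation3 (ground M) (rk M) P e Q \<or> separation3 (ground M) (rk (matroid_dual M)) P e Q"
proof -
  interpret D: matroid "matroid_dual M" by (rule matroid_dual)
  have "\<not> contractible M e \<or> \<not> contractible (matroid_dual M) e"
    using ne e cosimplification_delete_connected_iff[OF e]
    unfolding elastic_def deletable_def contractible_def by auto
  thus ?thesis
    using separation3_of_not_contractible[OF conn e] D.separation3_of_not_contractible[of e] n_connected_dual conn e
    by auto
qed

end

section \<open>Recognising \<Theta>-separators\<close>

text \<open>Dependence in \<open>\<Theta>\<^sub>n\<close> of \<open>{z\<^sub>i | i \<in> J} \<union> {w\<^sub>i | i \<in> K}\<close>, for an arbitrary index set \<open>V\<close>.\<close>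

definition theta_dependent :: "'a set \<Rightarrow> 'a set \<Rightarrow> 'a set \<Rightarrow> bool" where
  "theta_dependent V J K \<longleftrightarrow> 3 \<le> card K \<or> (\<exists>i\<in>K. V - {i} \<subseteq> J) \<or>
     (\<exists>i\<in>V. \<exists>j\<in>K. \<exists>k\<in>K. i \<noteq> j \<and> i \<noteq> k \<and> j \<noteq> k \<and> V - {i} \<subseteq> J)"

lemma theta_dependent_image:
  assumes g: "bij_betw g V V'" and J: "J \<subseteq> V" and K: "K \<subseteq> V"
  shows "theta_dependent V' (g ` J) (g ` K) \<longleftrightarrow> theta_dependent V J K"
proof -
  have inj: "inj_on g V" and img: "g ` V = V'" using g by (auto simp: bij_betw_def)
  have c: "card (g ` K) = card K" using inj K by (intro card_image) (rule inj_on_subset)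
  have eq: "g i = g j \<longleftrightarrow> i = j" if "i \<in> V" "j \<in> V" for i j using inj_onD[OF inj] that by blast
  have sub: "V' - {g i} \<subseteq> g ` J \<longleftrightarrow> V - {i} \<subseteq> J" if "i \<in> V" for i
  proof
    assume a: "V' - {g i} \<subseteq> g ` J"
    show "V - {i} \<subseteq> J"
    proof
      fix x assume x: "x \<in> V - {i}"
      hence "g x \<in> g ` J" using a img eq[of x i] that by auto
      thus "x \<in> J" using x J eq by blast
    qed
  qed (use img in auto)
  have 1: "(\<exists>i\<in>g ` K. V' - {i} \<subseteq> g ` J) \<longleftrightarrow> (\<exists>i\<in>K. V - {i} \<subseteq> J)" using sub K by blast
  have "(\<exists>i\<in>V'. \<exists>j\<in>g ` K. \<exists>k\<in>g ` K. i \<noteq> j \<and> i \<noteq> k \<and> j \<noteq> k \<and> V' - {i} \<subseteq> g ` J) \<longleftrightarrow>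
    (\<exists>i\<in>V. \<exists>j\<in>K. \<exists>k\<in>K. g i \<noteq> g j \<and> g i \<noteq> g k \<and> g j \<noteq> g k \<and> V' - {g i} \<subseteq> g ` J)"
    unfolding img[symmetric] by simp
  also have "\<dots> \<longleftrightarrow> (\<exists>i\<in>V. \<exists>j\<in>K. \<exists>k\<in>K. i \<noteq> j \<and> i \<noteq> k \<and> j \<noteq> k \<and> V - {i} \<subseteq> J)"
    using sub eq K by (meson subsetD)
  finally show ?thesis unfolding theta_dependent_def c 1 by simp
qed

lemma ex_theta_circuit_iff:
  "(\<exists>C\<in>theta_circuits n. P C) \<longleftrightarrow> (\<exists>C. C \<subseteq> W ` {1..n} \<and> card C = 3 \<and> P C) \<or>
     (\<exists>i\<in>{1..n}. P ((Z ` {1..n} - {Z i}) \<union> {W i})) \<or>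
     (\<exists>i j k. i \<in> {1..n} \<and> j \<in> {1..n} \<and> k \<in> {1..n} \<and> i \<noteq> j \<and> i \<noteq> k \<and> j \<noteq> k \<and>
        P ((Z ` {1..n} - {Z i}) \<union> {W j, W k}))"
  unfolding theta_circuits_def bex_Un by blast

lemma theta_indep_iff:
  assumes J: "J \<subseteq> {1..n}" and K: "K \<subseteq> {1..n}"
  shows "indep (theta n) (Z ` J \<union> W ` K) \<longleftrightarrow> \<not> theta_dependent {1..n} J K"
proof -
  have Zsub: "Z ` {1..n} - {Z i} \<subseteq> Z ` J \<union> W ` K \<longleftrightarrow> {1..n} - {i} \<subseteq> J" for i by auto
  have 1: "(\<exists>C. C \<subseteq> W ` {1..n} \<and> card C = 3 \<and> C \<subseteq> Z ` J \<union> W ` K) \<longleftrightarrow> 3 \<le> card K"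
  proof
    assume "\<exists>C. C \<subseteq> W ` {1..n} \<and> card C = 3 \<and> C \<subseteq> Z ` J \<union> W ` K"
    then obtain C where C: "C \<subseteq> W ` {1..n}" "card C = 3" "C \<subseteq> Z ` J \<union> W ` K" by blast
    have "C \<subseteq> W ` K" using C by auto
    hence "card C \<le> card (W ` K)" using finite_subset[OF K] by (intro card_mono) auto
    also have "\<dots> = card K" by (intro card_image) (auto intro: inj_onI)
    finally show "3 \<le> card K" using C by simp
  next
    assume "3 \<le> card K"
    then obtain K' where K': "K' \<subseteq> K" "card K' = 3" by (meson obtain_subset_with_card_n)
    moreover have "card (W ` K') = card K'" by (intro card_image) (auto intro: inj_onI)
    ultimately show "\<exists>C. C \<subseteq> W ` {1..n} \<and> card C = 3 \<and> C \<subseteq> Z ` J \<union> W ` K"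
      using K by (intro exI[of _ "W ` K'"]) auto
  qed
  have 2: "(\<exists>i\<in>{1..n}. (Z ` {1..n} - {Z i}) \<union> {W i} \<subseteq> Z ` J \<union> W ` K) \<longleftrightarrow> (\<exists>i\<in>K. {1..n} - {i} \<subseteq> J)"
    using Zsub K by auto
  have 3: "(\<exists>i j k. i \<in> {1..n} \<and> j \<in> {1..n} \<and> k \<in> {1..n} \<and> i \<noteq> j \<and> i \<noteq> k \<and> j \<noteq> k \<and>
      (Z ` {1..n} - {Z i}) \<union> {W j, W k} \<subseteq> Z ` J \<union> W ` K) \<longleftrightarrow>
    (\<exists>i\<in>{1..n}. \<exists>j\<in>K. \<exists>k\<in>K. i \<noteq> j \<and> i \<noteq> k \<and> j \<noteq> k \<and> {1..n} - {i} \<subseteq> J)"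
  proof -
    define p where "p i \<longleftrightarrow> {1..n} - {i} \<subseteq> J" for i
    have "(Z ` {1..n} - {Z i}) \<union> {W j, W k} \<subseteq> Z ` J \<union> W ` K \<longleftrightarrow> p i \<and> j \<in> K \<and> k \<in> K" for i j k
      using Zsub unfolding p_def by auto
    moreover have "k \<in> {1..n}" if "k \<in> K" for k using K that by blast
    ultimately show ?thesis unfolding p_def[symmetric] by metis
  qed
  have "(\<exists>C\<in>theta_circuits n. C \<subseteq> Z ` J \<union> W ` K) \<longleftrightarrow> theta_dependent {1..n} J K"
    unfolding theta_dependent_def 1[symmetric] 2[symmetric] 3[symmetric] by (rule ex_theta_circuit_iff)
  moreover have "Z ` J \<union> W ` K \<subseteq> W ` {1..n} \<union> Z ` {1..n}" using J K by auto
  ultimately show ?thesis unfolding theta_def by auto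
qed

lemma matroid_iso_from_inverse:
  assumes g: "bij_betw g (ground T) (ground N)"
    and ind: "\<And>X. X \<subseteq> ground T \<Longrightarrow> indep T X \<longleftrightarrow> indep N (g ` X)"
  shows "matroid_iso N T"
  unfolding matroid_iso_def
proof (intro exI conjI allI impI)
  let ?f = "inv_into (ground T) g"
  show f: "bij_betw ?f (ground N) (ground T)" using g by (rule bij_betw_inv_into)
  fix X assume X: "X \<subseteq> ground N"
  have "?f ` X \<subseteq> ground T" using f X by (auto simp: bij_betw_def)
  moreover have "g ` ?f ` X = X" using X g by (simp add: bij_betw_def image_inv_into_cancel)
  ultimately show "indep N X \<longleftrightarrow> indep T (?f ` X)" using ind by metis
qed

context connected_pair begin

text \<open>The dual restricted to \<open>L\<close> and the partners is \<open>\<Theta>\<^sub>n\<close> or \<open>\<Theta>\<^sub>n\<^sup>-\<close>, with the elements \<open>f\<close> of \<open>L\<close> as indices. A set is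
independent in the dual iff its complement spans. The line is coindependent and spans the partners in the dual; since
\<open>\<lambda>(L) = 2\<close>, the partners have corank two. Conversely, two elements of \<open>L\<close> in the complement span \<open>L\<close>,
so only sets \<open>J\<close> that miss at most one element of \<open>L\<close> need care; the critical one is \<open>(L - {i}) \<union> {z j}\<close> with \<open>i \<noteq> j\<close>,
which is handled by submodularity against \<open>(L - {j}) \<union> {z j}\<close>.\<close>

lemma theta_dependent_iff:
  assumes Wd: "L \<subseteq> E" "r L \<le> 2" "4 \<le> card L" and B: "B \<subseteq> L" "card L \<le> card B + 1"
    and z: "inj_on z B" "z ` B \<subseteq> E - L" "\<forall>f\<in>B. r (E - insert (z f) (L - {f})) < r E"
  shows "s L = int (card L)" "s (z ` B) \<le> 2"
    and "J \<subseteq> L \<Longrightarrow> K \<subseteq> B \<Longrightarrow> s (J \<union> z ` K) = int (card (J \<union> z ` K)) \<longleftrightarrow> \<not> theta_dependent L J K"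
proof -
  interpret D: connected_pair E s r by (rule dual_conn)
  note z3 = bspec[OF z(3)]
  have finW: "finite L" "finite B" using Wd B finite_sub finite_subset by blast+
  have zBE: "z ` B \<subseteq> E" using z by auto
  have cz: "card (z ` K) = card K" if "K \<subseteq> B" for K using z(1) that by (intro card_image) (rule inj_on_subset)
  have "card (z ` B) \<le> card (E - L)" using z fin by (intro card_mono) auto
  hence "2 \<le> card (E - L)" using cz[of B] B Wd by simp
  hence l2: "2 \<le> lam L" using conn2[of L] Wd by auto
  have "r (E - L) \<le> r E" by (intro r_mono) auto
  hence rEW: "r (E - L) = r E" using l2 lam_eq[of L] Wd by simp
  show sW: "s L = int (card L)" using s_eq[of L] Wd rEW by simp
  hence l2: "lam L \<le> 2" using Wd by (simp add: lam_def)
  have zcl: "z f \<in> D.cl L" if "f \<in> B" for f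
  proof -
    have "r (E - insert (z f) L) \<le> r (E - insert (z f) (L - {f}))" by (intro r_mono) auto
    hence "r (E - insert (z f) L) < r E" using z3[OF that] by simp
    moreover have "z f \<in> E" "z f \<notin> L" "insert (z f) L \<subseteq> E" using z(2) that Wd by auto
    ultimately have "s (insert (z f) L) \<le> s L" using s_eq[of "insert (z f) L"] sW finW by simp
    thus ?thesis using D.r_step[of L "z f"] Wd \<open>z f \<in> E\<close> unfolding D.cl_def by auto
  qed
  have sWz: "s (L \<union> z ` B) = int (card L)" using D.r_Un_cl[of L "z ` B"] zcl Wd sW by auto
  have sEW: "s (E - L) \<le> s E + 2 - int (card L)"
    using l2 D.lam_eq[of L] Wd sW by (simp add: lam_def D.lam_def)
  have "s ((L \<union> z ` B) \<union> (E - L)) + s ((L \<union> z ` B) \<inter> (E - L)) \<le> s (L \<union> z ` B) + s (E - L)"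
    using Wd zBE by (intro D.r_submod) auto
  moreover have "(L \<union> z ` B) \<union> (E - L) = E" "(L \<union> z ` B) \<inter> (E - L) = z ` B" using Wd z by auto
  ultimately show sz: "s (z ` B) \<le> 2" using sWz sEW by simp
  assume J: "J \<subseteq> L" and K: "K \<subseteq> B"
  let ?I = "J \<union> z ` K"
  have IE: "?I \<subseteq> E" "z ` K \<subseteq> E" "J \<inter> z ` K = {}" proof -
    have "z ` K \<subseteq> z ` B" using K by blast
    hence "z ` K \<subseteq> E - L" using z(2) by blast
    thus "?I \<subseteq> E" "z ` K \<subseteq> E" "J \<inter> z ` K = {}" using J Wd(1) by auto
  qed
  have ind: "s ?I = int (card ?I) \<longleftrightarrow> r (E - ?I) = r E" using s_eq[OF IE(1)] by auto
  have finJK: "finite J" "finite K" "finite (z ` K)" using finW J K finite_subset by blast+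
  have cI: "card ?I = card J + card K" using cz[OF K] IE finJK by (simp add: card_Un_disjoint)
  have dep: "s ?I \<noteq> int (card ?I)" if d: "theta_dependent L J K"
  proof
    assume "s ?I = int (card ?I)"
    hence full: "r (E - ?I) = r E" using ind by simp
    consider "3 \<le> card K" | i where "i \<in> K" "L - {i} \<subseteq> J"
      | i j k where "i \<in> L" "j \<in> K" "k \<in> K" "j \<noteq> k" "L - {i} \<subseteq> J"
      using d unfolding theta_dependent_def by blast
    thus False
    proof cases
      case 1
      have "r (E - ?I) \<le> r (E - z ` K)" by (intro r_mono) auto
      moreover have "r (E - z ` K) \<le> r E" by (intro r_mono) auto
      ultimately have "s (z ` K) = int (card K)" using s_eq[OF IE(2)] cz[OF K] full by simp
      moreover have "s (z ` K) \<le> s (z ` B)" using K zBE by (intro D.r_mono) auto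
      ultimately show False using sz 1 by simp
    next
      case 2
      have "r (E - ?I) \<le> r (E - insert (z i) (L - {i}))" using 2 by (intro r_mono) auto
      thus False using full z3[of i] 2 K by auto
    next
      case 3
      have "{j,k} \<subseteq> K" using 3 by simp
      hence "2 \<le> card K" using card_mono[OF finJK(2), of "{j,k}"] 3 by simp
      moreover have "card (L - {i}) \<le> card J" using 3 finJK by (intro card_mono) auto
      hence "card L \<le> card J + 1" using 3 finW by simp
      ultimately have "card L < card ?I" using cI by simp
      moreover have "s ?I \<le> s (L \<union> z ` B)" using J K Wd zBE by (intro D.r_mono) auto
      ultimately show False using \<open>s ?I = int (card ?I)\<close> sWz by simp
    qed
  qed
  have indp: "r (E - ?I) = r E" if nd: "\<not> theta_dependent L J K"
  proof -
    have up: "r (E - ?I) \<le> r E" by (intro r_mono) auto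
    \<comment> \<open>Sets of at most two elements are coindependent, and here \<open>K\<close> is one.\<close>
    have K2: "card K \<le> 2" using nd unfolding theta_dependent_def by auto
    have Zfull: "r (E - X) = r E" if "X \<subseteq> E" "card X \<le> 2" for X
    proof -
      have "finite X" using that finite_sub by blast
      consider "card X = 0" | "card X = 1" | "card X = 2" using \<open>card X \<le> 2\<close> by linarith
      thus ?thesis
      proof cases
        case 1 thus ?thesis using \<open>finite X\<close> by simp
      next
        case 2 thus ?thesis using r_del1 that by (auto simp: card_1_singleton_iff)
      next
        case 3 thus ?thesis using r_pair(2) that by (auto simp: card_2_iff)
      qed
    qed
    have span: "r (A \<union> L) = r A" if "A \<subseteq> E" "a \<in> A" "b \<in> A" "a \<in> L" "b \<in> L" "a \<noteq> b" for A a b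
    proof -
      have "L \<subseteq> cl {a,b}" using that Wd by (intro line_cl) auto
      also have "\<dots> \<subseteq> cl A" using that by (intro cl_mono) auto
      finally show ?thesis using that by (intro r_Un_cl) auto
    qed
    show ?thesis
    proof (cases "2 \<le> card (L - J)")
      case True
      then obtain a b where ab: "a \<in> L - J" "b \<in> L - J" "a \<noteq> b" by (rule two_elems)
      have "a \<in> E - ?I" "b \<in> E - ?I" using ab z K Wd by auto
      hence "r ((E - ?I) \<union> L) = r (E - ?I)" using ab by (intro span[of _ a b]) auto
      moreover have "r (E - z ` K) \<le> r ((E - ?I) \<union> L)" using J Wd by (intro r_mono) auto
      moreover have "r (E - z ` K) = r E" using Zfull[OF IE(2)] cz[OF K] K2 by simp
      ultimately show ?thesis using up by simp
    next
      case False
      have WJ: "r (E - L) \<le> r (E - J)" using J by (intro r_mono) auto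
      show ?thesis
      proof (cases "K = {}")
        case True
        thus ?thesis using WJ rEW up by simp
      next
        case Kne: False
        then obtain j where j: "j \<in> K" by blast
        have "\<not> L - {j} \<subseteq> J" using nd j unfolding theta_dependent_def by blast
        then obtain i where i: "i \<in> L" "i \<noteq> j" "i \<notin> J" by blast
        have "L - J \<subseteq> {i}" using False card_le_Suc0_iff_eq[of "L - J"] finW i by auto
        hence Ji: "J = L - {i}" using i J by auto
        have "K = {j}"
        proof (rule ccontr)
          assume "K \<noteq> {j}"
          then obtain k where k: "k \<in> K" "k \<noteq> j" using j by blast
          moreover have "k \<noteq> i" using nd k Ji unfolding theta_dependent_def by auto
          ultimately show False using nd j i Ji unfolding theta_dependent_def by blast
        qed
        define X1 X2 where "X1 = E - ?I" and "X2 = E - insert (z j) (L - {j})"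
        have zj: "z j \<in> E" "z j \<notin> L" using z j K by auto
        have jW: "j \<in> L" using j K B by auto
        have X1: "X1 = E - insert (z j) (L - {i})" using \<open>K = {j}\<close> Ji unfolding X1_def by auto
        have X: "X1 \<union> X2 = E - insert (z j) (L - {i,j})" "X1 \<inter> X2 = E - L - {z j}"
          using i(1,2) jW zj unfolding X1 X2_def by auto
        have XE: "X1 \<union> X2 \<subseteq> E" unfolding X1_def X2_def by auto
        have "i \<in> E" "j \<in> E" "z j \<noteq> i" "z j \<noteq> j" using i(1) jW zj(2) Wd(1) by auto
        hence "i \<in> X1 \<union> X2" "j \<in> X1 \<union> X2" unfolding X(1) by auto
        hence "r ((X1 \<union> X2) \<union> L) = r (X1 \<union> X2)" using XE i(1,2) jW by (intro span[of _ i j])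
        moreover have "E - {z j} \<subseteq> (X1 \<union> X2) \<union> L" unfolding X(1) by auto
        hence "r (E - {z j}) \<le> r ((X1 \<union> X2) \<union> L)" using XE Wd(1) by (intro r_mono) simp_all
        moreover have "r (E - {z j}) = r E" by (rule r_del1[OF zj(1)])
        moreover have "r (X1 \<union> X2) + r (X1 \<inter> X2) \<le> r X1 + r X2"
          unfolding X1_def X2_def by (intro r_submod) auto
        moreover have "r X2 < r E" using z3[of j] j K unfolding X2_def by auto
        moreover have "r E \<le> r (X1 \<inter> X2) + 1" using r_diff_card[of "E - L" "{z j}"] zj rEW X by simp
        ultimately have "r E \<le> r X1" by linarith
        thus ?thesis using up unfolding X1_def by simp
      qed
    qed
  qed
  show "s ?I = int (card ?I) \<longleftrightarrow> \<not> theta_dependent L J K" using dep indp ind by blast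
qed

end

text \<open>An enumeration of \<open>L\<close> induces the isomorphism. If one element has no partner, it must receive the index 1, as
\<open>\<Theta>\<^sub>n\<^sup>-\<close> is \<open>\<Theta>\<^sub>n\<close> without \<open>w\<^sub>1\<close>.\<close>

lemma theta_iso_exists:
  assumes L: "card L = n" "3 \<le> n" and B: "B \<subseteq> L" "card L \<le> card B + 1"
    and z: "inj_on z B" "z ` B \<inter> L = {}" and gN: "ground N = L \<union> z ` B"
    and ind: "\<And>J K. J \<subseteq> L \<Longrightarrow> K \<subseteq> B \<Longrightarrow> indep N (J \<union> z ` K) \<longleftrightarrow> \<not> theta_dependent L J K"
  shows "matroid_iso N (theta n) \<or> matroid_iso N (theta_minus n)"
proof -
  have finL: "finite L" using L by (metis card.infinite not_numeral_le_zero)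
  have iso: "matroid_iso N T"
    if g: "bij_betw g {1..n} L" and gB: "g ` D = B" and D: "D \<subseteq> {1..n}"
      and gT: "ground T = W ` D \<union> Z ` {1..n}" and iT: "\<And>X. X \<subseteq> ground T \<Longrightarrow> indep T X = indep (theta n) X" for g D T
  proof -
    define h where "h x = (case x of Z i \<Rightarrow> g i | W i \<Rightarrow> z (g i))" for x
    have hZW: "h ` (Z ` J \<union> W ` K) = g ` J \<union> z ` g ` K" for J K
      unfolding h_def by (auto simp: image_Un image_image)
    have ginj: "inj_on g {1..n}" and gL: "g ` {1..n} = L" using g by (auto simp: bij_betw_def)
    show ?thesis
    proof (rule matroid_iso_from_inverse[of h])
      have "h ` ground T = ground N" using hZW[of "{1..n}" D] gT gB gL gN by (simp add: Un_commute)
      moreover have "inj_on h (ground T)"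
      proof (rule inj_onI)
        fix x y assume xy: "x \<in> ground T" "y \<in> ground T" "h x = h y"
        have gD: "g i \<in> B" if "i \<in> D" for i using gB that by blast
        have gLm: "g i \<in> L" if "i \<in> {1..n}" for i using gL that by blast
        have ne: "z (g i) \<noteq> g j" if "i \<in> D" "j \<in> {1..n}" for i j
          using gD[OF that(1)] gLm[OF that(2)] z(2) by auto
        have zz: "i = j" if "i \<in> D" "j \<in> D" "z (g i) = z (g j)" for i j
          using inj_onD[OF z(1) that(3)] gD that inj_onD[OF ginj] D by blast
        have gg: "i = j" if "i \<in> {1..n}" "j \<in> {1..n}" "g i = g j" for i j
          using inj_onD[OF ginj that(3)] that by blast
        have memW: "i \<in> D" if "W i \<in> ground T" for i using that gT by auto
        have memZ: "i \<in> {1..n}" if "Z i \<in> ground T" for i using that gT by auto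
        have hW: "h (W i) = z (g i)" and hZ: "h (Z i) = g i" for i by (simp_all add: h_def)
        show "x = y"
        proof (cases x)
          case x: (W i)
          show ?thesis
          proof (cases y)
            case (W j)
            thus ?thesis using x xy zz[of i j] hW memW by metis
          next
            case (Z j)
            thus ?thesis using x xy ne[of i j] hW hZ memW
                memZ by metis
          qed
        next
          case x: (Z i)
          show ?thesis
          proof (cases y)
            case (W j)
            thus ?thesis using x xy ne[of j i] hW hZ memW
                memZ by metis
          next
            case (Z j)
            thus ?thesis using x xy gg[of i j] hZ memZ by metis
          qed
        qed
      qed
      ultimately show "bij_betw h (ground T) (ground N)" by (simp add: bij_betw_def)
    next
      fix X assume X: "X \<subseteq> ground T"
      define J K where "J = {i. Z i \<in> X}" and "K = {i. W i \<in> X}"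
      have X': "X = Z ` J \<union> W ` K"
      proof
        show "X \<subseteq> Z ` J \<union> W ` K"
        proof
          fix x assume "x \<in> X" thus "x \<in> Z ` J \<union> W ` K" unfolding J_def K_def by (cases x) auto
        qed
      qed (auto simp: J_def K_def)
      have JK: "J \<subseteq> {1..n}" "K \<subseteq> D" using X gT unfolding J_def K_def by auto
      have "indep T X \<longleftrightarrow> \<not> theta_dependent {1..n} J K"
        using iT[OF X] theta_indep_iff[of J n K] JK D X' by auto
      also have "\<dots> \<longleftrightarrow> \<not> theta_dependent L (g ` J) (g ` K)"
        using theta_dependent_image[OF g, of J K] JK D by auto
      also have "\<dots> \<longleftrightarrow> indep N (g ` J \<union> z ` g ` K)"
        using JK gL gB by (intro ind[symmetric]) auto
      finally show "indep T X \<longleftrightarrow> indep N (h ` X)" using hZW[of J K] X' by simp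
    qed
  qed
  show ?thesis
  proof (cases "B = L")
    case True
    obtain g where "bij_betw g {1..n} L" using ex_bij_betw_nat_finite_1[OF finL] L by blast
    hence "matroid_iso N (theta n)"
      using True by (intro iso[of g "{1..n}"]) (auto simp: theta_def bij_betw_def)
    thus ?thesis ..
  next
    case False
    then obtain w where w: "w \<in> L" "w \<notin> B" using B by blast
    have finB: "finite B" using finL B finite_subset by blast
    have "card (insert w B) = Suc (card B)" using w finB by simp
    hence Lw: "insert w B = L" using B w finL by (intro card_seteq) auto
    hence "card {2..n} = card B" using L w finB by auto
    then obtain g' where g': "bij_betw g' {2..n} B" using finite_same_card_bij[of "{2..n}" B] finB by auto
    define g where "g = g'(1 := w)"
    have "bij_betw g {2..n} B" using g' unfolding g_def by (subst bij_betw_cong[of _ _ g']) auto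
    moreover have "g 1 = w" unfolding g_def by simp
    moreover have "{1..n} = insert 1 {2..n}" using L by auto
    ultimately have "bij_betw g {1..n} L" "g ` {2..n} = B"
      using notIn_Un_bij_betw[of 1 "{2..n}" g B] w Lw by (auto simp: bij_betw_def)
    hence "matroid_iso N (theta_minus n)"
    proof (rule iso)
      show g2: "ground (theta_minus n) = W ` {2..n} \<union> Z ` {1..n}"
      proof -
        have "W ` {1..n} - {W 1} = W ` {2..n}" by auto
        thus ?thesis unfolding theta_minus_def matroid_delete_def matroid_restrict_def theta_def by auto
      qed
      show "indep (theta_minus n) X = indep (theta n) X" if "X \<subseteq> ground (theta_minus n)" for X
        using that unfolding theta_minus_def matroid_delete_def matroid_restrict_def by auto
    qed auto
    thus ?thesis ..
  qed
qed

section \<open>Counting elastic elements\<close>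

lemma (in matroid) connected_pair_of_3_connected:
  assumes "n_connected 3 M" "7 \<le> card (ground M)"
  shows "connected_pair (ground M) (rk M) (rk (matroid_dual M))"
proof -
  interpret P: rank_pair "ground M" "rk M" "rk (matroid_dual M)" by (rule rank_pair_dual)
  show ?thesis
  proof
    fix A assume A: "A \<subseteq> ground M"
    show "1 \<le> P.lam A" if "A \<noteq> {}" "A \<noteq> ground M"
      using three_connectedD(1)[OF assms(1) A that finite_ground] P.lam_eq[OF A] by simp
    show "2 \<le> P.lam A" if "2 \<le> card A" "2 \<le> card (ground M - A)"
      using three_connectedD(2)[OF assms(1) A that] P.lam_eq[OF A] by simp
  qed (rule assms)
qed

lemma (in matroid) theta_separator_of_configuration:
  assumes conn: "n_connected 3 M" "7 \<le> card (ground M)"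
    and th: "theta_configuration (ground M) (rk M)"
  shows "\<exists>S. theta_separator M S"
proof -
  interpret C: connected_pair "ground M" "rk M" "rk (matroid_dual M)"
    by (rule connected_pair_of_3_connected[OF conn])
  interpret CD: connected_pair "ground M" "rk (matroid_dual M)" "rk M" by (rule C.dual_conn)
  from th obtain L B z where th': "L \<subseteq> ground M \<and> rk M L \<le> 2 \<and> 4 \<le> card L \<and> 4 \<le> rk M (ground M) \<and>
      B \<subseteq> L \<and> card L \<le> card B + 1 \<and> inj_on z B \<and> z ` B \<subseteq> ground M - L \<and>
      (\<forall>f\<in>B. rk M (ground M - insert (z f) (L - {f})) < rk M (ground M))"
    unfolding theta_configuration_def by (elim exE) (rule that)
  then have L: "L \<subseteq> ground M" "rk M L \<le> 2" "4 \<le> card L" and R: "4 \<le> rk M (ground M)"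
    and B: "B \<subseteq> L" "card L \<le> card B + 1" and z: "inj_on z B" "z ` B \<subseteq> ground M - L"
      "\<forall>f\<in>B. rk M (ground M - insert (z f) (L - {f})) < rk M (ground M)"
    by simp_all
  note T = C.theta_dependent_iff[OF L B z]
  define S where "S = L \<union> z ` B"
  have SE: "S \<subseteq> ground M" using L z unfolding S_def by auto
  interpret D: matroid "matroid_dual M" by (rule matroid_dual)
  let ?N = "matroid_restrict (matroid_dual M) S"
  have "matroid_iso ?N (theta (card L)) \<or> matroid_iso ?N (theta_minus (card L))"
  proof (rule theta_iso_exists[OF refl _ B z(1)])
    show "ground ?N = L \<union> z ` B" using SE unfolding S_def by auto
    fix J K assume J: "J \<subseteq> L" and K: "K \<subseteq> B"
    have JS: "J \<union> z ` K \<subseteq> S" using J K unfolding S_def by auto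
    hence "J \<union> z ` K \<subseteq> ground (matroid_dual M)" using SE by auto
    from D.indep_iff_rank[OF this] JS have "indep ?N (J \<union> z ` K) \<longleftrightarrow> rk (matroid_dual M) (J \<union> z ` K) = int (card (J \<union> z ` K))"
      unfolding matroid_restrict_def by simp
    thus "indep ?N (J \<union> z ` K) \<longleftrightarrow> \<not> theta_dependent L J K" using T(3)[OF J K] by simp
  qed (use L z in auto)
  moreover have "3 \<le> card L" using L by simp
  ultimately have "\<exists>n\<ge>3. \<exists>N\<in>{matroid_restrict M S, ?N}. matroid_iso N (theta n) \<or> matroid_iso N (theta_minus n)"
    by blast
  moreover have "rk M L = 2"
  proof -
    have "2 \<le> card L" using L by simp
    then obtain x y where "x \<in> L" "y \<in> L" "x \<noteq> y" by (rule C.two_elems)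
    thus ?thesis using C.r_ge2[OF L(1)] L(2) by force
  qed
  moreover have "rk (matroid_dual M) (z ` B) = 2"
  proof -
    have "card (z ` B) = card B" using z by (intro card_image)
    hence "2 \<le> card (z ` B)" using L B by simp
    then obtain x y where "x \<in> z ` B" "y \<in> z ` B" "x \<noteq> y" by (rule C.two_elems)
    moreover have "z ` B \<subseteq> ground M" using z by auto
    ultimately show ?thesis using CD.r_ge2[of "z ` B"] T(2) by force
  qed
  moreover have "4 \<le> rk (matroid_dual M) (ground M)"
    using CD.r_mono[of L "ground M"] T(1) L by simp
  ultimately have "theta_separator M S"
    using R L z unfolding theta_separator_def rk_def S_def
    by (intro conjI exI[of _ L] exI[of _ "z ` B"]) auto
  thus ?thesis by blast
qed

lemma (in matroid) theta_separator_dual: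
  assumes "theta_separator (matroid_dual M) S" shows "theta_separator M S"
  using assms unfolding theta_separator_def dual_dual by (auto simp: Un_commute)

lemma (in matroid) triangle_of_rank:
  assumes abc: "{a,b,c} \<subseteq> ground M" "distinct [a,b,c]" "rk M {a,b,c} \<le> 2"
    and pairs: "\<And>x y. x \<in> ground M \<Longrightarrow> y \<in> ground M \<Longrightarrow> x \<noteq> y \<Longrightarrow> rk M {x,y} = 2"
  shows "triangle M {a,b,c}"
proof -
  have c: "card {a,b,c} = 3" using abc by simp
  have ip: "indep M {x,y}" if "x \<in> {a,b,c}" "y \<in> {a,b,c}" "x \<noteq> y" for x y
  proof -
    have "{x,y} \<subseteq> ground M" using that abc by blast
    thus ?thesis using indep_iff_rank[of "{x,y}"] pairs[of x y] that by simp
  qed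
  have "indep M I" if "I \<subset> {a,b,c}" for I
  proof -
    have "a \<notin> I \<or> b \<notin> I \<or> c \<notin> I" "I \<subseteq> {a,b,c}" using that by auto
    hence "I \<subseteq> {b,c} \<or> I \<subseteq> {a,c} \<or> I \<subseteq> {a,b}" by auto
    moreover have "indep M {b,c}" "indep M {a,c}" "indep M {a,b}" using ip abc(2) by auto
    ultimately show ?thesis using indep_subset by blast
  qed
  moreover have "\<not> indep M {a,b,c}" using indep_iff_rank[OF abc(1)] abc(3) c by simp
  ultimately show ?thesis using abc(1) c unfolding triangle_def circuit_def by blast
qed

theorem corollary2:
  fixes M :: "'a pre_matroid"
  assumes "matroid M"
    and "n_connected 3 M"
  shows "(card (ground M) \<ge> 7 \<longrightarrow> \<not> (\<exists>F. four_element_fan M F) \<longrightarrow> \<not> (\<exists>S. theta_separator M S) \<longrightarrow>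
            card {e \<in> ground M. elastic M e} \<ge> 4)
         \<and> (card (ground M) \<le> 6 \<longrightarrow> (\<forall>e\<in>ground M. elastic M e))"
proof (intro conjI impI ballI)
  interpret matroid M by fact
  interpret D: matroid "matroid_dual M" by (rule matroid_dual)
  let ?E = "ground M" and ?s = "rk (matroid_dual M)"
  note sep = separation3_of_not_elastic[OF assms(2)]
  {
    fix e assume small: "card ?E \<le> 6" and e: "e \<in> ?E"
    show "elastic M e"
    proof (rule ccontr)
      interpret P: rank_pair ?E "rk M" ?s by (rule rank_pair_dual)
      interpret PD: rank_pair ?E ?s "rk M" by (rule P.dual)
      assume "\<not> elastic M e"
      then obtain P Q where S: "separation3 ?E (rk M) P e Q \<or> separation3 ?E ?s P e Q" using sep[OF e] by blast
      hence PQ: "?E = insert e (P \<union> Q)" "e \<notin> P" "e \<notin> Q" "P \<inter> Q = {}" unfolding separation3_def by auto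
      hence sub: "P \<subseteq> ?E" "Q \<subseteq> ?E" by auto
      have "3 \<le> card P" "3 \<le> card Q"
        using S P.r_le_card[OF sub(1)] P.r_le_card[OF sub(2)] PD.r_le_card[OF sub(1)] PD.r_le_card[OF sub(2)]
        unfolding separation3_def by auto
      moreover have "card (insert e (P \<union> Q)) = Suc (card P + card Q)"
        using PQ(2-4) P.finite_sub[OF sub(1)] P.finite_sub[OF sub(2)] by (simp add: card_Un_disjoint)
      ultimately show False using small unfolding PQ(1)[symmetric] by simp
    qed
  next
    assume big: "7 \<le> card ?E" and nf: "\<not> (\<exists>F. four_element_fan M F)" and nt: "\<not> (\<exists>S. theta_separator M S)"
    interpret C: connected_pair ?E "rk M" ?s by (rule connected_pair_of_3_connected[OF assms(2) big])
    interpret CD: connected_pair ?E ?s "rk M" by (rule C.dual_conn)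
    have "tame_pair ?E (rk M) ?s"
    proof
      show False if "distinct [a,b,c,d]" "{a,b,c,d} \<subseteq> ?E" "rk M {a,b,c} \<le> 2" "?s {b,c,d} \<le> 2" for a b c d
      proof -
        have "triangle M {a,b,c}" using that C.r_pair(1) by (intro triangle_of_rank) auto
        moreover have "triangle (matroid_dual M) {b,c,d}" using that CD.r_pair(1) by (intro D.triangle_of_rank) auto
        hence "triad M {b,c,d}" unfolding triad_def cocircuit_def triangle_def .
        moreover have "card {a,b,c,d} = 4" using that by simp
        ultimately have "four_element_fan M {a,b,c,d}" using that(2) unfolding four_element_fan_def by blast
        thus False using nf by blast
      qed
      show "\<not> theta_configuration ?E (rk M)"
        using theta_separator_of_configuration[OF assms(2) big] nt by blast
      show "\<not> theta_configuration ?E ?s"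
      proof
        assume "theta_configuration ?E ?s"
        hence "\<exists>S. theta_separator (matroid_dual M) S"
          using D.theta_separator_of_configuration n_connected_dual assms(2) big by simp
        thus False using theta_separator_dual nt by blast
      qed
    qed
    then interpret T: tame_pair ?E "rk M" ?s .
    have el: "elastic M e" if "e \<in> ?E" "\<not> T.blocked e" for e
      using sep[OF that(1)] that(2) unfolding T.blocked_def by blast
    show "4 \<le> card {e \<in> ?E. elastic M e}"
    proof (cases "\<forall>e\<in>?E. elastic M e")
      case True
      hence "{e \<in> ?E. elastic M e} = ?E" by auto
      thus ?thesis using big by simp
    next
      case False
      then obtain e P Q where e: "e \<in> ?E" and S: "separation3 ?E (rk M) P e Q \<or> separation3 ?E ?s P e Q"
        using sep by blast
      have P: "2 \<le> T.num_unblocked P" by (rule T.two_unblocked_in_side[OF S])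
      have "separation3 ?E (rk M) Q e P \<or> separation3 ?E ?s Q e P" 
        using S separation3_sym[of ?E _ P e Q] by auto
      hence Q: "2 \<le> T.num_unblocked Q" by (rule T.two_unblocked_in_side)
      have PQ: "P \<subseteq> ?E" "Q \<subseteq> ?E" "P \<inter> Q = {}" using S unfolding separation3_def by auto
      have "{f \<in> P. \<not> T.blocked f} \<union> {f \<in> Q. \<not> T.blocked f} \<subseteq> {e \<in> ?E. elastic M e}" using el PQ by auto
      hence "card ({f \<in> P. \<not> T.blocked f} \<union> {f \<in> Q. \<not> T.blocked f}) \<le> card {e \<in> ?E. elastic M e}"
        using finite_ground by (intro card_mono) auto
      moreover have "card ({f \<in> P. \<not> T.blocked f} \<union> {f \<in> Q. \<not> T.blocked f}) = T.num_unblocked P + T.num_unblocked Q"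
        using PQ C.finite_sub by (intro card_Un_disjoint) auto
      ultimately show ?thesis using P Q by simp
    qed
  }
qed

end
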